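(* For every integer $k\ge 0$, the curve $\mathscr{S}_{k,2}\subset\mathcal{M}_3$ is irreducible.
   Context: For $a,b\in\mathbb{C}$ let $f_{a,b}(z)=z^3-3a^2z+2a^3+b$; its finite critical points are $\pm a$, the marked critical point is $a$, and $f_{a,b}(a)=b$. The polynomials $f_{a,b}$ and $f_{a',b'}$ (with marked critical points $a$, $a'$) are affinely conjugate, respecting marked critical points, iff $(a',b')=\pm(a,b)$. The moduli space of cubic polynomials with a marked critical point is $\mathcal{M}_3=\mathbb{C}^2/\big((a,b)\sim(-a,-b)\big)$, an affine variety identified with the image of $\mathbb{C}^2\to\mathbb{C}^3$, $(a,b)\mapsto(a^2,ab,b^2)$. $f^m$ denotes the $m$-fold iterate ($f^0=\mathrm{Id}$). A point $x$ is strictly $n$-periodic under $f$ if $n$ is the smallest positive integer with $f^n(x)=x$. A point $x$ is strictly $(k,n)$-preperiodic if $f^k(x)$ is strictly $n$-periodic and $f^l(x)$ is not periodic for any $0\le l<k$. For integers $k\ge0$, $n\ge1$, $\mathscr{S}_{k,n}$ is the set of all points (classes of) $(a,b)\in\mathcal{M}_3$ such that $a$ is strictly $(k,n)$-preperiodic under $f_{a,b}$. Irreducibility is in the sense of the Zariski topology over $\mathbb{C}$: the Zariski closure of $\mathscr{S}_{k,n}$ in $\mathcal{M}_3$ (which differs from $\mathscr{S}_{k,n}$ by finitely many points) is an irreducible algebraic curve. *)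

theory Defs
  imports "HOL-Analysis.Analysis"
begin

section \<open>The Zariski topology on complex affine space\<close>

inductive_set polyfuns :: "(complex^'n \<Rightarrow> complex) set" where
  const: "(\<lambda>_. c) \<in> polyfuns"
| coord: "(\<lambda>x. x $ i) \<in> polyfuns"
| add: "p \<in> polyfuns \<Longrightarrow> q \<in> polyfuns \<Longrightarrow> (\<lambda>x. p x + q x) \<in> polyfuns"
| mult: "p \<in> polyfuns \<Longrightarrow> q \<in> polyfuns \<Longrightarrow> (\<lambda>x. p x * q x) \<in> polyfuns"

definition zero_locus :: "(complex^'n \<Rightarrow> complex) set \<Rightarrow> (complex^'n) set" where
  "zero_locus P = {x. \<forall>p\<in>P. p x = 0}"

definition zariski :: "(complex^'n) topology" where
  "zariski = topology (\<lambda>U. \<exists>P\<subseteq>polyfuns. U = - zero_locus P)"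

lemma zero_locus_Un:
  "zero_locus P \<union> zero_locus Q = zero_locus {\<lambda>x. p x * q x | p q. p \<in> P \<and> q \<in> Q}"
proof (intro equalityI subsetI)
  fix x assume "x \<in> zero_locus P \<union> zero_locus Q"
  then show "x \<in> zero_locus {\<lambda>x. p x * q x | p q. p \<in> P \<and> q \<in> Q}"
    by (auto simp: zero_locus_def)
next
  fix x assume x: "x \<in> zero_locus {\<lambda>x. p x * q x | p q. p \<in> P \<and> q \<in> Q}"
  have *: "p x * q x = 0" if "p \<in> P" "q \<in> Q" for p q
  proof -
    have "(\<lambda>x. p x * q x) \<in> {\<lambda>x. p x * q x | p q. p \<in> P \<and> q \<in> Q}"
      unfolding mem_Collect_eq using that by (intro exI[of _ p] exI[of _ q]) simp
    moreover have "\<forall>r\<in>{\<lambda>x. p x * q x | p q. p \<in> P \<and> q \<in> Q}. r x = 0"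
      using x unfolding zero_locus_def by (rule CollectD)
    ultimately have "(\<lambda>x. p x * q x) x = 0"
      by (rule bspec[rotated])
    then show ?thesis .
  qed
  show "x \<in> zero_locus P \<union> zero_locus Q"
  proof (rule ccontr)
    assume "x \<notin> zero_locus P \<union> zero_locus Q"
    then obtain p q where "p \<in> P" "p x \<noteq> 0" "q \<in> Q" "q x \<noteq> 0"
      unfolding zero_locus_def by blast
    with *[of p q] show False by simp
  qed
qed

lemma istopology_zariski:
  "istopology (\<lambda>U::(complex^'n) set. \<exists>P\<subseteq>polyfuns. U = - zero_locus P)"
  unfolding istopology_def
proof (intro conjI allI impI)
  fix S T :: "(complex^'n) set"
  assume "\<exists>P\<subseteq>polyfuns. S = - zero_locus P" "\<exists>P\<subseteq>polyfuns. T = - zero_locus P"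
  then obtain P Q where PQ: "P \<subseteq> polyfuns" "S = - zero_locus P" "Q \<subseteq> polyfuns" "T = - zero_locus Q"
    by blast
  let ?R = "{\<lambda>x. p x * q x | p q. p \<in> P \<and> q \<in> Q}"
  have "?R \<subseteq> polyfuns"
    using PQ polyfuns.mult by blast
  moreover have "S \<inter> T = - zero_locus ?R"
    using PQ by (simp flip: zero_locus_Un)
  ultimately show "\<exists>P\<subseteq>polyfuns. S \<inter> T = - zero_locus P"
    by blast
next
  fix \<K> :: "(complex^'n) set set"
  assume "\<forall>K\<in>\<K>. \<exists>P\<subseteq>polyfuns. K = - zero_locus P"
  then obtain P where P: "\<And>K. K \<in> \<K> \<Longrightarrow> P K \<subseteq> polyfuns \<and> K = - zero_locus (P K)"
    by metis
  have "\<Union>\<K> = - zero_locus (\<Union>K\<in>\<K>. P K)"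
  proof (intro set_eqI iffI)
    fix x assume "x \<in> \<Union>\<K>"
    then obtain K where K: "K \<in> \<K>" "x \<in> K" by blast
    then have "x \<notin> zero_locus (P K)" using P by blast
    then show "x \<in> - zero_locus (\<Union>K\<in>\<K>. P K)"
      using K(1) by (auto simp: zero_locus_def)
  next
    fix x assume "x \<in> - zero_locus (\<Union>K\<in>\<K>. P K)"
    then obtain K where K: "K \<in> \<K>" "x \<notin> zero_locus (P K)"
      by (auto simp: zero_locus_def)
    then have "x \<in> K" using P by blast
    with K(1) show "x \<in> \<Union>\<K>" by blast
  qed
  moreover have "(\<Union>K\<in>\<K>. P K) \<subseteq> polyfuns"
    using P by blast
  ultimately show "\<exists>P\<subseteq>polyfuns. \<Union>\<K> = - zero_locus P"
    by blast
qed

lemma openin_zariski: "openin zariski U \<longleftrightarrow> (\<exists>P\<subseteq>polyfuns. U = - zero_locus P)"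
  unfolding zariski_def topology_inverse'[OF istopology_zariski] ..

lemma topspace_zariski [simp]: "topspace zariski = UNIV"
proof -
  have "openin zariski (UNIV :: (complex^'n) set)"
    unfolding openin_zariski
    by (intro exI[of _ "{\<lambda>_. 1}"]) (auto simp: zero_locus_def intro: polyfuns.const)
  then show ?thesis
    using openin_subset by blast
qed

lemma closedin_zariski: "closedin zariski Z \<longleftrightarrow> (\<exists>P\<subseteq>polyfuns. Z = zero_locus P)"
  unfolding closedin_def openin_zariski by auto


section \<open>Irreducibility, dimension, curves\<close>

definition irreducible_space :: "'a topology \<Rightarrow> bool" where
  "irreducible_space X \<longleftrightarrow> topspace X \<noteq> {} \<and>
     (\<forall>A B. closedin X A \<and> closedin X B \<and> A \<union> B = topspace X
        \<longrightarrow> A = topspace X \<or> B = topspace X)"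

definition irreducible_in :: "'a topology \<Rightarrow> 'a set \<Rightarrow> bool" where
  "irreducible_in X S \<longleftrightarrow> S \<subseteq> topspace X \<and> irreducible_space (subtopology X S)"

text \<open>Krull dimension: the supremum of the lengths \<open>n\<close> of chains
  \<open>Z 0 \<subset> \<dots> \<subset> Z n\<close> of irreducible closed subsets.  The empty space gets dimension 0.\<close>

definition krull_dim :: "'a topology \<Rightarrow> enat" where
  "krull_dim X = Sup {enat n | n. \<exists>Z :: nat \<Rightarrow> 'a set.
     (\<forall>i\<le>n. closedin X (Z i) \<and> irreducible_in X (Z i)) \<and> (\<forall>i<n. Z i \<subset> Z (Suc i))}"

definition irreducible_curve :: "'a topology \<Rightarrow> 'a set \<Rightarrow> bool" where
  "irreducible_curve X C \<longleftrightarrow>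
     closedin X C \<and> irreducible_in X C \<and> krull_dim (subtopology X C) = 1"


section \<open>Periodic and preperiodic points\<close>

definition periodic_point :: "('a \<Rightarrow> 'a) \<Rightarrow> 'a \<Rightarrow> bool" where
  "periodic_point f x \<longleftrightarrow> (\<exists>n>0. (f ^^ n) x = x)"

definition strictly_periodic :: "nat \<Rightarrow> ('a \<Rightarrow> 'a) \<Rightarrow> 'a \<Rightarrow> bool" where
  "strictly_periodic n f x \<longleftrightarrow>
     n > 0 \<and> (f ^^ n) x = x \<and> (\<forall>m. 0 < m \<and> m < n \<longrightarrow> (f ^^ m) x \<noteq> x)"

definition strictly_preperiodic :: "nat \<Rightarrow> nat \<Rightarrow> ('a \<Rightarrow> 'a) \<Rightarrow> 'a \<Rightarrow> bool" where
  "strictly_preperiodic k n f x \<longleftrightarrow>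
     strictly_periodic n f ((f ^^ k) x) \<and> (\<forall>l<k. \<not> periodic_point f ((f ^^ l) x))"


section \<open>Cubic polynomials with a marked critical point\<close>

definition cubic :: "complex \<Rightarrow> complex \<Rightarrow> complex \<Rightarrow> complex" where
  "cubic a b z = z ^ 3 - 3 * a\<^sup>2 * z + 2 * a ^ 3 + b"

text \<open>The moduli space is the quotient of the \<open>(a, b)\<close>-plane by \<open>(a, b) \<sim> (-a, -b)\<close>, realised as
  the image of the map \<open>moduli_pt\<close>, whose fibres are exactly the equivalence classes.\<close>

definition moduli_pt :: "complex \<Rightarrow> complex \<Rightarrow> complex^3" where
  "moduli_pt a b = vector [a\<^sup>2, a * b, b\<^sup>2]"

lemma moduli_pt_eq_iff:
  "moduli_pt a b = moduli_pt a' b' \<longleftrightarrow> (a', b') = (a, b) \<or> (a', b') = (- a, - b)"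
proof
  assume "moduli_pt a b = moduli_pt a' b'"
  then have eq: "a\<^sup>2 = a'\<^sup>2" "a * b = a' * b'" "b\<^sup>2 = b'\<^sup>2"
    unfolding moduli_pt_def vec_eq_iff forall_3 by simp_all
  have "a' = a \<or> a' = - a"
    using eq(1) power2_eq_iff[of a' a] by simp
  moreover have "b' = b \<or> b' = - b"
    using eq(3) power2_eq_iff[of b' b] by simp
  ultimately consider "a' = a" "b' = b" | "a' = - a" "b' = - b"
      | "a' = a" "b' = - b" | "a' = - a" "b' = b"
    by blast
  then show "(a', b') = (a, b) \<or> (a', b') = (- a, - b)"
  proof cases
    case 3
    with eq(2) have "a = 0 \<or> b = 0" by simp
    with 3 show ?thesis by auto
  next
    case 4
    with eq(2) have "a = 0 \<or> b = 0" by simp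
    with 4 show ?thesis by auto
  qed simp_all
qed (auto simp: moduli_pt_def)

definition M3 :: "(complex^3) topology" where
  "M3 = subtopology zariski {moduli_pt a b | a b. True}"

definition preper_locus :: "nat \<Rightarrow> nat \<Rightarrow> (complex^3) set" where
  "preper_locus k n = {moduli_pt a b | a b. strictly_preperiodic k n (cubic a b) a}"

end

(* Put u = b - a and let x_j = f^j(a), a polynomial in a and u. For k >= 2 the curve is the zero
   set of R = 1 + (x_k - x_(k-1)) (x_(k-1) + x_k + x_(k+1)), divided by E = 1 + u (u + 3a) if k is
   odd (E is the equation of the locus k = 0). Call this polynomial F; it is monic in u.

   F is irreducible over the integers by an Eisenstein argument at the ideal (3, u^2 + 1):
   modulo 3 the map f is the Frobenius up to a translation, which makes R a power of u^2 + 1,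
   while modulo E the polynomial F is 3 times an element outside that ideal.

   F stays irreducible over the complex numbers because the curve has a branch at infinity with
   rational Laurent coefficients in 1/a: x_1, ..., x_(k-1) are close to -2a and x_k, x_(k+1) are
   close to a + 1, a - 1. A complex polynomial of degree less than deg F in u that vanishes on the
   branch yields, by applying a Q-linear functional to its coefficients, an integral one, which is
   impossible. Hence F divides every complex polynomial vanishing on the branch, and is prime. *)

theory Submission
  imports Defs
    "HOL-Computational_Algebra.Polynomial_Factorial"
    "HOL-Computational_Algebra.Formal_Laurent_Series"
    "HOL-Computational_Algebra.Fundamental_Theorem_Algebra"
begin

section \<open>Polynomials\<close>

text \<open>Irreducibility over Z alone does not suffice: u^2 + 1 is irreducible there and splits
  over C. This is what happens for k = 1, where R = (u^2 + 1) E: the locus in the (a, u)-plane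
  consists of two lines, and only its image in the moduli space is irreducible. For other k, a
  splitting of F over C would be into Galois conjugate factors; if one of them vanishes on a branch
  with rational coefficients, so do all its conjugates. Hence the insistence on a rational branch.
  The prime 3 comes from the degree of f, since cubing is additive modulo 3. As -1 is not a square
  modulo 3, the ideal (3, u^2 + 1) is prime, with quotient F_9[a]. The Eisenstein condition is that
  F avoids the square of this ideal, which is read off from F modulo E. The factor E occurs for odd
  k because R then vanishes also where a itself has period 2. There the orbit returns to a critical
  point, near which f is quadratic, and so the orbit can be computed modulo E^2.\<close>

lemma monic_division:
  fixes f g :: "'a::idom poly"
  assumes "lead_coeff g = 1"
  obtains q r where "f = g * q + r" "r = 0 \<or> degree r < degree g"
proof -
  obtain q r where qr: "pseudo_divmod f g = (q, r)" by fastforce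
  have "g \<noteq> 0" using assms by auto
  from pseudo_divmod[OF this qr] show ?thesis
    using assms that by simp
qed

text \<open>An element of minimal degree in the ideal \<open>(F, G)\<close> divides \<open>F\<close> and \<open>G\<close> up to constants,
  so it is itself a constant.\<close>

lemma prime_elem_bezout:
  fixes F G :: "'a::idom poly"
  assumes F: "prime_elem F" "degree F > 0" and G: "\<not> F dvd G"
  obtains \<alpha> \<gamma> r where "\<alpha> * F + \<gamma> * G = [:r:]" "r \<noteq> 0"
proof -
  define I where "I = {\<alpha> * F + \<gamma> * G | \<alpha> \<gamma>. True}"
  have FI: "F \<in> I" unfolding I_def by (rule CollectI, rule exI[of _ 1], rule exI[of _ 0]) simp
  have GI: "G \<in> I" unfolding I_def by (rule CollectI, rule exI[of _ 0], rule exI[of _ 1]) simp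
  have "F \<noteq> 0" using F by auto
  with FI have "\<exists>m. m \<in> I \<and> m \<noteq> 0" by blast
  from ex_has_least_nat[of "\<lambda>m. m \<in> I \<and> m \<noteq> 0", of _ degree] this
  obtain m where m: "m \<in> I" "m \<noteq> 0" and least: "\<And>p. p \<in> I \<Longrightarrow> p \<noteq> 0 \<Longrightarrow> degree m \<le> degree p"
    by blast
  have dvd: "\<exists>c q. c \<noteq> 0 \<and> smult c p = m * q" if p: "p \<in> I" for p
  proof -
    obtain c q where cq: "c \<noteq> 0" "smult c p = m * q + pseudo_mod p m"
      using pseudo_mod(1)[OF m(2)] by blast
    obtain a1 a2 where "p = a1 * F + a2 * G" using p unfolding I_def by blast
    moreover obtain b1 b2 where "m = b1 * F + b2 * G" using m(1) unfolding I_def by blast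
    ultimately have "pseudo_mod p m = (smult c a1 - b1 * q) * F + (smult c a2 - b2 * q) * G"
      using cq(2) by (simp add: algebra_simps smult_add_right)
    then have "pseudo_mod p m \<in> I" unfolding I_def by blast
    with least pseudo_mod(2)[OF m(2), of p] have "pseudo_mod p m = 0" by fastforce
    with cq show ?thesis by auto
  qed
  have "degree m = 0"
  proof (rule ccontr)
    assume deg: "degree m \<noteq> 0"
    obtain c q where cq: "c \<noteq> 0" "smult c F = m * q" using dvd[OF FI] by blast
    obtain d s where ds: "d \<noteq> 0" "smult d G = m * s" using dvd[OF GI] by blast
    \<comment> \<open>\<open>F\<close> is prime and divides m q = c F. If it divides m, it divides d
      G and hence \<open>G\<close>; if it divides q, cancelling \<open>F\<close> leaves m as a
      divisor of the constant c.\<close>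
    have "F dvd m * q" using cq(2) by (metis dvd_refl dvd_smult)
    then consider "F dvd m" | "F dvd q" using F(1) prime_elem_dvd_multD by blast
    then show False
    proof cases
      case 1
      then have "F dvd [:d:] * G" using ds by simp
      with G F(1) have "F dvd [:d:]" using prime_elem_dvd_multD by blast
      with dvd_imp_degree_le[OF this] ds F(2) show False by simp
    next
      case 2
      then obtain q' where "q = F * q'" by blast
      with cq have "F * [:c:] = F * (m * q')" by (simp add: algebra_simps)
      with \<open>F \<noteq> 0\<close> have eq: "[:c:] = m * q'" by (metis mult_cancel_left)
      with cq have "q' \<noteq> 0" by auto
      have "degree (m * q') = 0" unfolding eq[symmetric] by simp
      with m \<open>q' \<noteq> 0\<close> deg show False by (simp add: degree_mult_eq)
    qed
  qed
  then obtain r where "m = [:r:]" by (rule degree_eq_zeroE)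
  moreover obtain \<alpha> \<gamma> where "m = \<alpha> * F + \<gamma> * G" using m(1) unfolding I_def by blast
  ultimately show ?thesis using m(2) that[of \<alpha> \<gamma> r] by auto
qed

section \<open>Ring homomorphisms and evaluation of polynomials\<close>

definition is_hom :: "('a::comm_ring_1 \<Rightarrow> 'b::comm_ring_1) \<Rightarrow> bool" where
  "is_hom h \<longleftrightarrow> h 1 = 1 \<and> (\<forall>x y. h (x + y) = h x + h y) \<and> (\<forall>x y. h (x * y) = h x * h y)"

lemma is_hom_1: "is_hom h \<Longrightarrow> h 1 = 1"
  and is_hom_add: "is_hom h \<Longrightarrow> h (x + y) = h x + h y"
  and is_hom_mult: "is_hom h \<Longrightarrow> h (x * y) = h x * h y"
  by (auto simp: is_hom_def)

lemma is_hom_0: assumes "is_hom h" shows "h 0 = 0"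
  using is_hom_add[OF assms, of 0 0] by simp

lemma is_hom_uminus: assumes "is_hom h" shows "h (- x) = - h x"
  using is_hom_add[OF assms, of x "- x"] is_hom_0[OF assms]
  by (simp add: eq_neg_iff_add_eq_0 add.commute)

lemma is_hom_diff: assumes "is_hom h" shows "h (x - y) = h x - h y"
  using is_hom_add[OF assms, of x "- y"] is_hom_uminus[OF assms] by simp

lemma is_hom_power: assumes "is_hom h" shows "h (x ^ n) = h x ^ n"
  by (induction n) (simp_all add: is_hom_1[OF assms] is_hom_mult[OF assms])

lemma is_hom_of_nat: assumes "is_hom h" shows "h (of_nat n) = of_nat n"
  by (induction n) (simp_all add: is_hom_0[OF assms] is_hom_1[OF assms] is_hom_add[OF assms])

lemma is_hom_numeral: assumes "is_hom h" shows "h (numeral n) = numeral n"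
  using is_hom_of_nat[OF assms, of "numeral n"] by simp

lemma is_hom_of_int: assumes "is_hom h" shows "h (of_int n) = of_int n"
  by (cases n rule: int_diff_cases) (simp add: is_hom_diff[OF assms] is_hom_of_nat[OF assms])

lemmas is_hom_simps = is_hom_0 is_hom_1 is_hom_add is_hom_mult is_hom_uminus is_hom_diff
  is_hom_power is_hom_numeral is_hom_of_int

definition eval_hom :: "('a::comm_ring_1 \<Rightarrow> 'b::comm_ring_1) \<Rightarrow> 'b \<Rightarrow> 'a poly \<Rightarrow> 'b" where
  "eval_hom h x p = poly (map_poly h p) x"

lemma eval_hom_0 [simp]: "eval_hom h x 0 = 0"
  by (simp add: eval_hom_def)

lemma eval_hom_pCons: "is_hom h \<Longrightarrow> eval_hom h x (pCons c p) = h c + x * eval_hom h x p"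
  by (simp add: eval_hom_def map_poly_pCons is_hom_0)

lemma is_hom_eval_hom: assumes h: "is_hom h" shows "is_hom (eval_hom h x)"
proof -
  note simps = eval_hom_pCons[OF h] is_hom_0[OF h] is_hom_add[OF h] is_hom_mult[OF h]
  have add: "eval_hom h x (p + q) = eval_hom h x p + eval_hom h x q" for p q
    by (induction p q rule: poly_induct2) (simp_all add: simps algebra_simps)
  have smult: "eval_hom h x (smult c p) = h c * eval_hom h x p" for c p
    by (induction p) (simp_all add: simps algebra_simps)
  have "eval_hom h x (p * q) = eval_hom h x p * eval_hom h x q" for p q
    by (induction p) (simp_all add: simps add smult algebra_simps)
  moreover have "eval_hom h x 1 = 1"
    by (simp add: one_pCons simps is_hom_1[OF h])
  ultimately show ?thesis by (simp add: is_hom_def add)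
qed

lemma is_hom_of_int_fun: "is_hom (of_int :: int \<Rightarrow> 'a::comm_ring_1)"
  by (simp add: is_hom_def)

lemma is_hom_id: "is_hom (\<lambda>x. x)"
  by (simp add: is_hom_def)

lemma is_hom_fls_const: "is_hom (fls_const :: 'a::comm_ring_1 \<Rightarrow> 'a fls)"
  by (simp add: is_hom_def fls_plus_const)

section \<open>An Eisenstein criterion at the ideal (3, u^2 + 1)\<close>

text \<open>Modulo p the factors have degree at most n and m, so only one summand of the convolution
  survives. This gives access to leading terms modulo p without forming a quotient ring.\<close>

lemma coeff_mult_top_mod:
  fixes f g :: "'a::comm_ring_1 poly"
  assumes f: "\<And>i. i > n \<Longrightarrow> p dvd coeff f i" and g: "\<And>j. j > m \<Longrightarrow> p dvd coeff g j"
  shows "p dvd coeff (f * g) (n + m) - coeff f n * coeff g m"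
proof -
  have "coeff (f * g) (n + m) = (\<Sum>i\<le>n+m. coeff f i * coeff g (n + m - i))"
    by (rule coeff_mult)
  also have "\<dots> = coeff f n * coeff g m + (\<Sum>i\<in>{..n+m}-{n}. coeff f i * coeff g (n + m - i))"
    by (subst sum.remove[of _ n]) auto
  finally have "coeff (f * g) (n + m) - coeff f n * coeff g m
      = (\<Sum>i\<in>{..n+m}-{n}. coeff f i * coeff g (n + m - i))" by simp
  also have "p dvd \<dots>"
  proof (rule dvd_sum)
    fix i assume i: "i \<in> {..n+m}-{n}"
    then consider "i > n" | "n + m - i > m" by fastforce
    then show "p dvd coeff f i * coeff g (n + m - i)"
      by cases (simp_all add: f g dvd_mult dvd_mult2)
  qed
  finally show ?thesis .
qed

lemma three_dvd_sum_squares_int: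
  fixes x y :: int
  assumes "3 dvd x * x + y * y"
  shows "3 dvd x \<and> 3 dvd y"
proof -
  have "x mod 3 = 0 \<or> x mod 3 = 1 \<or> x mod 3 = 2" "y mod 3 = 0 \<or> y mod 3 = 1 \<or> y mod 3 = 2"
    by presburger+
  moreover have "((x mod 3) * (x mod 3) mod 3 + (y mod 3) * (y mod 3) mod 3) mod 3 = 0"
    using assms unfolding mod_mult_eq mod_add_eq by presburger
  ultimately show ?thesis
    unfolding dvd_eq_mod_eq_0 by (elim disjE) simp_all
qed

lemma three_dvd_poly_iff: "3 dvd (p :: int poly) \<longleftrightarrow> (\<forall>n. 3 dvd coeff p n)"
  using const_poly_dvd_iff[of 3 p] by (simp add: numeral_poly)

lemma three_dvd_poly_poly_iff: "3 dvd (p :: int poly poly) \<longleftrightarrow> (\<forall>n. 3 dvd coeff p n)"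
  using const_poly_dvd_iff[of 3 p] by (simp add: numeral_poly)

text \<open>The larger of the two degrees modulo p, so that leading terms can be compared at a
  common index. With \<open>f = g\<close> it is the degree of a single polynomial modulo p.\<close>

lemma last_index_not_dvd:
  fixes f :: "'a::comm_semiring_1 poly"
  assumes "\<exists>n. \<not> p dvd coeff f n \<or> \<not> p dvd coeff g n"
  obtains n where "\<not> p dvd coeff f n \<or> \<not> p dvd coeff g n"
    "\<And>i. i > n \<Longrightarrow> p dvd coeff f i" "\<And>i. i > n \<Longrightarrow> p dvd coeff g i"
proof -
  let ?P = "\<lambda>n. \<not> p dvd coeff f n \<or> \<not> p dvd coeff g n"
  have b: "n \<le> max (degree f) (degree g)" if "?P n" for n
    using that by (metis coeff_eq_0 dvd_0_right le_max_iff_disj linorder_not_less)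
  then have "?P (GREATEST n. ?P n)" "\<And>i. i > (GREATEST n. ?P n) \<Longrightarrow> \<not> ?P i"
    using GreatestI_ex_nat[of ?P] Greatest_le_nat[of ?P] assms by (meson linorder_not_less)+
  then show ?thesis using that by blast
qed

text \<open>At the common top index modulo 3 the leading terms of the two squares cannot cancel,
  because -1 is not a square modulo 3.\<close>

lemma three_dvd_sum_squares_poly:
  fixes f g :: "int poly"
  assumes "3 dvd f * f + g * g"
  shows "3 dvd f \<and> 3 dvd g"
proof (rule ccontr)
  assume "\<not> ?thesis"
  then have "\<exists>n. \<not> 3 dvd coeff f n \<or> \<not> 3 dvd coeff g n"
    by (auto simp: three_dvd_poly_iff)
  then obtain n where n: "\<not> 3 dvd coeff f n \<or> \<not> 3 dvd coeff g n"
    "\<And>i. i > n \<Longrightarrow> 3 dvd coeff f i" "\<And>i. i > n \<Longrightarrow> 3 dvd coeff g i"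
    using last_index_not_dvd[of 3 f g] by metis
  have "3 dvd coeff (f * f) (n + n) - coeff f n * coeff f n"
    "3 dvd coeff (g * g) (n + n) - coeff g n * coeff g n"
    using n by (auto intro!: coeff_mult_top_mod)
  moreover have "3 dvd coeff (f * f) (n + n) + coeff (g * g) (n + n)"
    using assms unfolding three_dvd_poly_iff by simp
  ultimately have "3 dvd coeff f n * coeff f n + coeff g n * coeff g n"
    by presburger
  with three_dvd_sum_squares_int n(1) show False by blast
qed

lemma prime_elem_3_int_poly: "prime_elem (3 :: int poly)"
proof -
  have "prime_elem (3 :: int)" by simp
  then have "prime_elem [:3 :: int:]" by (rule lift_prime_elem_poly)
  then show ?thesis by (simp add: numeral_poly)
qed

lemma prime_elem_3_int_poly_poly: "prime_elem (3 :: int poly poly)"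
  using lift_prime_elem_poly[OF prime_elem_3_int_poly] by (simp add: numeral_poly)

definition ideal3 :: "int poly poly set" where
  "ideal3 = {3 * x + [:1, 0, 1:] * y | x y. True}"

lemma ideal3_I: "p = 3 * x + [:1, 0, 1:] * y \<Longrightarrow> p \<in> ideal3"
  unfolding ideal3_def by blast

lemma ideal3_add:
  assumes "p \<in> ideal3" "q \<in> ideal3"
  shows "p + q \<in> ideal3"
proof -
  obtain x y where p: "p = 3 * x + [:1, 0, 1:] * y" using assms(1) unfolding ideal3_def by blast
  obtain z w where q: "q = 3 * z + [:1, 0, 1:] * w" using assms(2) unfolding ideal3_def by blast
  show ?thesis unfolding p q by (rule ideal3_I[of _ "x + z" "y + w"]) (simp only: algebra_simps)
qed

lemma ideal3_3: "3 dvd p \<Longrightarrow> p \<in> ideal3"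
  by (metis add.right_neutral dvd_def ideal3_I mult_zero_right)

text \<open>Once the multiplier of 3 is reduced modulo the monic u^2 + 1, the cofactor of u^2 + 1
  vanishes for degree reasons.\<close>

lemma ideal3_linear_iff: "[:f, g:] \<in> ideal3 \<longleftrightarrow> 3 dvd f \<and> 3 dvd g"
proof
  assume "[:f, g:] \<in> ideal3"
  then obtain x y where xy: "[:f, g:] = 3 * x + [:1, 0, 1:] * y" unfolding ideal3_def by blast
  obtain q r where qr: "x = [:1, 0, 1:] * q + r" "r = 0 \<or> degree r < degree [:1, 0, 1 :: int poly:]"
    by (rule monic_division[of "[:1, 0, 1:]" x]) auto
  define d where "d = [:f, g:] - 3 * r"
  have eq: "d = [:1, 0, 1:] * (3 * q + y)"
    unfolding d_def xy qr(1) by (simp add: algebra_simps)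
  have "degree r \<le> 1" using qr(2) by auto
  then have "degree (3 * r) \<le> 1" by (simp add: degree_mult_eq numeral_poly)
  then have "degree d \<le> 1" unfolding d_def by (intro degree_diff_le) auto
  have "3 * q + y = 0"
  proof (rule ccontr)
    assume "3 * q + y \<noteq> 0"
    then have "degree ([:1, 0, 1:] * (3 * q + y)) \<ge> 2" by (subst degree_mult_eq) auto
    with eq \<open>degree d \<le> 1\<close> show False by simp
  qed
  with eq have "3 dvd [:f, g:]" by (simp add: d_def)
  then have "3 dvd coeff [:f, g:] 0" "3 dvd coeff [:f, g:] 1"
    unfolding three_dvd_poly_poly_iff by blast+
  then show "3 dvd f \<and> 3 dvd g" by simp
next
  assume "3 dvd f \<and> 3 dvd g"
  then have "3 dvd [:f, g:]"
    unfolding three_dvd_poly_poly_iff by (simp add: coeff_pCons split: nat.split)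
  then show "[:f, g:] \<in> ideal3" by (rule ideal3_3)
qed

lemma ideal3_reduce:
  obtains f g y where "p = [:f, g:] + [:1, 0, 1:] * y" "p \<in> ideal3 \<longleftrightarrow> 3 dvd f \<and> 3 dvd g"
proof -
  obtain q r where qr: "p = [:1, 0, 1:] * q + r" "r = 0 \<or> degree r < degree [:1, 0, 1 :: int poly:]"
    by (rule monic_division[of "[:1, 0, 1:]" p]) auto
  have "degree r \<le> 1" using qr(2) by auto
  then have r: "r = [:coeff r 0, coeff r 1:]"
    by (intro poly_eqI) (auto simp: coeff_pCons coeff_eq_0 split: nat.splits)
  have "r \<in> ideal3 \<longleftrightarrow> p \<in> ideal3"
  proof
    assume "r \<in> ideal3"
    moreover have "[:1, 0, 1:] * q \<in> ideal3" by (rule ideal3_I[of _ 0 q]) simp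
    ultimately show "p \<in> ideal3" unfolding qr(1) by (rule ideal3_add[rotated])
  next
    assume "p \<in> ideal3"
    moreover have "[:1, 0, 1:] * (- q) \<in> ideal3" by (rule ideal3_I[of _ 0 "- q"]) simp
    ultimately have "p + [:1, 0, 1:] * (- q) \<in> ideal3" by (rule ideal3_add)
    moreover have "p + [:1, 0, 1:] * (- q) = r" unfolding qr(1)
      by (simp only: mult_minus_right add_diff_cancel_left' flip: diff_conv_add_uminus)
    ultimately show "r \<in> ideal3" by simp
  qed
  then have "p \<in> ideal3 \<longleftrightarrow> 3 dvd coeff r 0 \<and> 3 dvd coeff r 1"
    using ideal3_linear_iff r by metis
  moreover have "p = [:coeff r 0, coeff r 1:] + [:1, 0, 1:] * q"
    using qr(1) r by (metis add.commute)
  ultimately show ?thesis using that by blast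
qed

text \<open>The norm f^2 + g^2 of a remainder f + g u is multiplicative by the two-square identity,
  and 3 divides it exactly when the remainder lies in the ideal.\<close>

lemma ideal3_prime:
  assumes "p * q \<in> ideal3"
  shows "p \<in> ideal3 \<or> q \<in> ideal3"
proof -
  obtain f g y where p: "p = [:f, g:] + [:1, 0, 1:] * y" "p \<in> ideal3 \<longleftrightarrow> 3 dvd f \<and> 3 dvd g"
    by (rule ideal3_reduce)
  obtain h k z where q: "q = [:h, k:] + [:1, 0, 1:] * z" "q \<in> ideal3 \<longleftrightarrow> 3 dvd h \<and> 3 dvd k"
    by (rule ideal3_reduce)
  have "[:f, g:] * [:h, k:] = [:f * h - g * k, f * k + g * h:] + [:1, 0, 1:] * [:g * k:]"
    by (simp add: algebra_simps)
  then have eq: "p * q = [:f * h - g * k, f * k + g * h:]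
      + [:1, 0, 1:] * ([:g * k:] + [:f, g:] * z + y * [:h, k:] + [:1, 0, 1:] * y * z)"
    unfolding p(1) q(1) distrib_left distrib_right by (simp only: ac_simps)
  have "[:f * h - g * k, f * k + g * h:] \<in> ideal3"
  proof -
    let ?w = "[:g * k:] + [:f, g:] * z + y * [:h, k:] + [:1, 0, 1:] * y * z"
    have "[:1, 0, 1:] * (- ?w) \<in> ideal3" by (rule ideal3_I[of _ 0 "- ?w"]) simp
    from ideal3_add[OF assms this] show ?thesis unfolding eq
      by (simp only: mult_minus_right add.assoc add.right_inverse add_0_right)
  qed
  then have d: "3 dvd f * h - g * k" "3 dvd f * k + g * h"
    unfolding ideal3_linear_iff by blast+
  have "(f * f + g * g) * (h * h + k * k)
      = (f * h - g * k) * (f * h - g * k) + (f * k + g * h) * (f * k + g * h)"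
    by (simp add: algebra_simps)
  also have "3 dvd \<dots>" by (intro dvd_add dvd_mult d)
  finally have "3 dvd f * f + g * g \<or> 3 dvd h * h + k * k"
    using prime_elem_3_int_poly prime_elem_dvd_multD by blast
  then show ?thesis
    using three_dvd_sum_squares_poly[of f g] three_dvd_sum_squares_poly[of h k] p(2) q(2) by argo
qed

text \<open>The top coefficient of \<open>H\<close> modulo 3 reappears in the product, at an index
  that is positive if \<open>G\<close> has positive degree; the polynomial 1 has no such
  coefficient.\<close>

lemma monic_unit_mod_3:
  fixes G H :: "int poly poly"
  assumes G: "lead_coeff G = 1" and GH: "3 dvd G * H - 1"
  shows "degree G = 0"
proof (rule ccontr)
  assume deg: "degree G \<noteq> 0"
  have "\<not> 3 dvd H"
  proof
    assume "3 dvd H"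
    then have "3 dvd G * H" by simp
    with GH have "3 dvd G * H - (G * H - 1)" by (rule dvd_diff[rotated])
    then show False using prime_elem_3_int_poly_poly prime_elem_not_unit by fastforce
  qed
  then have "\<exists>n. \<not> 3 dvd coeff H n \<or> \<not> 3 dvd coeff H n"
    by (auto simp: three_dvd_poly_poly_iff)
  then obtain m where m: "\<not> 3 dvd coeff H m" "\<And>i. i > m \<Longrightarrow> 3 dvd coeff H i"
    using last_index_not_dvd[of 3 H H] by metis
  have "3 dvd coeff (G * H) (degree G + m) - coeff G (degree G) * coeff H m"
    using m by (intro coeff_mult_top_mod) (auto simp: coeff_eq_0)
  moreover have "3 dvd coeff (G * H - 1) (degree G + m)"
    using GH unfolding three_dvd_poly_poly_iff by blast
  ultimately have "3 dvd coeff (G * H - 1) (degree G + m)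
      - (coeff (G * H) (degree G + m) - coeff G (degree G) * coeff H m)"
    by (rule dvd_diff[rotated])
  then have "3 dvd coeff H m" using G deg by (simp add: coeff_eq_0)
  with m show False by blast
qed

text \<open>Let P = (3, e), which equals \<open>ideal3\<close>. Modulo 3 a factorization of
  \<open>F\<close> becomes one of a power of \<open>e\<close>, so a monic factor of positive degree
  lies in P. In a proper factorization both factors do, and \<open>F\<close> lies in the square of
  P; comparison with \<open>F = e * s + 3 * t\<close> then puts \<open>t\<close> into P.\<close>

lemma eisenstein_ideal3:
  fixes F e :: "int poly poly"
  assumes F: "lead_coeff F = 1" "degree F > 0"
    and e: "lead_coeff e = 1" "3 dvd e - [:1, 0, 1:]"
    and F_mod_3: "3 dvd F - e ^ N"
    and F_mod_e: "F = e * s + 3 * t" "t \<notin> ideal3"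
  shows "irreducible F"
proof -
  have e_ideal: "e * x + 3 * y \<in> ideal3" for x y
  proof -
    obtain w where w: "e - [:1, 0, 1:] = 3 * w" using e(2) by blast
    then have "e = 3 * w + [:1, 0, 1:]" by (simp add: algebra_simps)
    then show ?thesis by (intro ideal3_I[of _ "w * x + y" x]) (simp only: algebra_simps)
  qed
  have in_ideal: "\<exists>x y. p = e * x + 3 * y" if p: "p \<in> ideal3" for p
  proof -
    obtain w where w: "e - [:1, 0, 1:] = 3 * w" using e(2) by blast
    then have w: "[:1, 0, 1:] = e - 3 * w" by (simp add: algebra_simps)
    from p obtain x y where "p = 3 * x + [:1, 0, 1:] * y" unfolding ideal3_def by blast
    then have "p = e * y + 3 * (x - w * y)" unfolding w by (simp only: algebra_simps)
    then show ?thesis by blast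
  qed
  have "\<not> 3 dvd e"
  proof
    assume "3 dvd e"
    then have "3 dvd lead_coeff e" unfolding three_dvd_poly_poly_iff by blast
    with e(1) show False using prime_elem_3_int_poly prime_elem_not_unit by fastforce
  qed
  then have cancel_e: "3 dvd x" if "3 dvd e * x" for x
    using that prime_elem_dvd_multD[OF prime_elem_3_int_poly_poly] by blast
  \<comment> \<open>Descent on the exponent: P is prime, so H lies in P, and one factor
    \<open>e\<close> cancels modulo 3. At exponent 0, G is a unit modulo 3.\<close>
  have not_ideal: "degree G = 0" if "lead_coeff G = 1" "G \<notin> ideal3" "3 dvd G * H - e ^ n" for G H n
    using that(3)
  proof (induction n arbitrary: H)
    case 0
    then show ?case using monic_unit_mod_3[OF that(1)] by simp
  next
    case (Suc n)
    then obtain w where w: "G * H - e ^ Suc n = 3 * w" by blast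
    then have eq: "G * H = e * e ^ n + 3 * w" by (simp add: algebra_simps)
    then have "G * H \<in> ideal3" using e_ideal by metis
    with that(2) ideal3_prime have "H \<in> ideal3" by blast
    with in_ideal obtain x y where "H = e * x + 3 * y" by blast
    with eq have "e * (G * x - e ^ n) = 3 * (w - G * y)" by (simp add: algebra_simps)
    then have "3 dvd G * x - e ^ n" using cancel_e by (metis dvd_triv_left)
    then show ?case by (rule Suc.IH)
  qed
  show ?thesis
  proof (rule irreducibleI)
    show "F \<noteq> 0" using F by auto
    show "\<not> F dvd 1" using F(2) dvd_imp_degree_le[of F 1] by auto
  next
    fix G H assume GH: "F = G * H"
    define c where "c = lead_coeff G"
    define d where "d = lead_coeff H"
    have cd: "c * d = 1" using F(1) unfolding GH c_def d_def by (simp add: lead_coeff_mult)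
    \<comment> \<open>The leading coefficients are mutually inverse, so both factors can be made
      monic without changing the product.\<close>
    define G' where "G' = smult d G"
    define H' where "H' = smult c H"
    have lc: "lead_coeff G' = 1" "lead_coeff H' = 1"
      using cd unfolding G'_def H'_def lead_coeff_smult c_def d_def by (simp_all only: mult.commute)
    have F': "F = G' * H'" unfolding GH G'_def H'_def using cd by (simp add: mult.commute)
    have unit: "p dvd 1" if "degree p = 0" "lead_coeff p dvd 1" for p :: "int poly poly"
      using that by (auto elim!: degree_eq_zeroE simp: is_unit_const_poly_iff)
    have cd_unit: "c dvd 1" "d dvd 1" using cd by (metis dvd_triv_left dvd_triv_right)+
    have "c \<noteq> 0" "d \<noteq> 0" using cd by auto
    then have degs: "degree G' = degree G" "degree H' = degree H"
      unfolding G'_def H'_def by simp_all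
    show "G dvd 1 \<or> H dvd 1"
    proof (rule ccontr)
      assume "\<not> ?thesis"
      with unit cd_unit have "degree G \<noteq> 0" "degree H \<noteq> 0" unfolding c_def d_def by blast+
      then have "degree G' \<noteq> 0" "degree H' \<noteq> 0" using degs by auto
      moreover have "3 dvd G' * H' - e ^ N" "3 dvd H' * G' - e ^ N"
        using F_mod_3 unfolding F' by (simp_all add: mult.commute)
      ultimately have "G' \<in> ideal3" "H' \<in> ideal3"
        using not_ideal[OF lc(1)] not_ideal[OF lc(2)] by (metis, metis)
      then obtain g1 g2 h1 h2 where gh: "G' = e * g1 + 3 * g2" "H' = e * h1 + 3 * h2"
        using in_ideal by meson
      have eq: "e * (g1 * h1 * e + 3 * g1 * h2 + 3 * g2 * h1 - s) = 3 * (t - 3 * g2 * h2)"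
        using F_mod_e(1) unfolding F' gh by (simp add: algebra_simps)
      then have "3 dvd g1 * h1 * e + 3 * g1 * h2 + 3 * g2 * h1 - s"
        using cancel_e by (metis dvd_triv_left)
      then obtain w where "g1 * h1 * e + 3 * g1 * h2 + 3 * g2 * h1 - s = 3 * w" by blast
      with eq have "3 * (e * w) = 3 * (t - 3 * g2 * h2)" by (metis mult.left_commute)
      then have "e * w = t - 3 * g2 * h2" by simp
      then have "t = e * w + 3 * (g2 * h2)" by (simp add: algebra_simps)
      with e_ideal F_mod_e(2) show False by metis
    qed
  qed
qed

lemma int_poly_poly_prime_elem: "irreducible F \<Longrightarrow> prime_elem (F :: int poly poly)"
  by (rule irreducible_imp_prime_elem)

section \<open>Power series solutions\<close>

context
  includes fps_syntax and no vec_syntax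
begin

definition agree :: "nat \<Rightarrow> 'a fps \<Rightarrow> 'a fps \<Rightarrow> bool" where
  "agree n f g \<longleftrightarrow> (\<forall>m<n. f $ m = g $ m)"

lemma agree_refl: "agree n f f"
  by (simp add: agree_def)

lemma agree_add: "agree n f g \<Longrightarrow> agree n f' g' \<Longrightarrow> agree n (f + f') (g + g')"
  for f g :: "'a::comm_ring_1 fps"
  by (simp add: agree_def)

lemma agree_diff: "agree n f g \<Longrightarrow> agree n f' g' \<Longrightarrow> agree n (f - f') (g - g')"
  for f g :: "'a::comm_ring_1 fps"
  by (simp add: agree_def)

lemma agree_mult: "agree n f g \<Longrightarrow> agree n f' g' \<Longrightarrow> agree n (f * f') (g * g')"
  for f g :: "'a::comm_ring_1 fps"
  by (auto simp: agree_def fps_mult_nth intro!: sum.cong)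

lemma agree_power: "agree n f g \<Longrightarrow> agree n (f ^ k) (g ^ k)"
  for f g :: "'a::comm_ring_1 fps"
  by (induction k) (simp_all add: agree_refl agree_mult)

lemma agree_fps_X_mult: "agree n f g \<Longrightarrow> agree (Suc n) (fps_X * f) (fps_X * g)"
  for f g :: "'a::comm_ring_1 fps"
  by (auto simp: agree_def)

text \<open>The factor \<open>fps_X\<close> gains one order of agreement: maps of this shape are
  X-adic contractions.\<close>

lemma agree_affine:
  "agree n f g \<Longrightarrow> agree (Suc n) (c * (d + fps_X * f)) (c * (d + fps_X * g))"
  for f g :: "'a::comm_ring_1 fps"
  by (intro agree_mult agree_add agree_refl agree_fps_X_mult)

lemma agree_if:
  "(P \<Longrightarrow> agree n f g) \<Longrightarrow> (\<not> P \<Longrightarrow> agree n f' g') \<Longrightarrow>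
    agree n (if P then f else f') (if P then g else g')"
  by simp

lemmas agree_intros = agree_refl agree_add agree_diff agree_mult agree_power

definition rat_fps :: "complex fps set" where
  "rat_fps = {f. \<forall>n. f $ n \<in> \<rat>}"

lemma rat_fps_add: "f \<in> rat_fps \<Longrightarrow> g \<in> rat_fps \<Longrightarrow> f + g \<in> rat_fps"
  by (simp add: rat_fps_def)

lemma rat_fps_diff: "f \<in> rat_fps \<Longrightarrow> g \<in> rat_fps \<Longrightarrow> f - g \<in> rat_fps"
  by (simp add: rat_fps_def)

lemma rat_fps_mult: "f \<in> rat_fps \<Longrightarrow> g \<in> rat_fps \<Longrightarrow> f * g \<in> rat_fps"
  by (auto simp: rat_fps_def fps_mult_nth intro!: Rats_sum)

lemma rat_fps_const: "c \<in> \<rat> \<Longrightarrow> fps_const c \<in> rat_fps"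
  by (simp add: rat_fps_def)

lemma rat_fps_1: "1 \<in> rat_fps"
  using rat_fps_const[of 1] by simp

lemma rat_fps_numeral: "numeral n \<in> rat_fps"
  using rat_fps_const[of "numeral n"] by (simp add: numeral_fps_const)

lemma rat_fps_X: "fps_X \<in> rat_fps"
  by (simp add: rat_fps_def fps_X_def)

lemma rat_fps_power: "f \<in> rat_fps \<Longrightarrow> f ^ n \<in> rat_fps"
  by (induction n) (simp_all add: rat_fps_1 rat_fps_mult)

lemma rat_fps_uminus: "f \<in> rat_fps \<Longrightarrow> - f \<in> rat_fps"
  by (simp add: rat_fps_def)

lemmas rat_fps_intros = rat_fps_add rat_fps_diff rat_fps_mult rat_fps_const rat_fps_1
  rat_fps_numeral rat_fps_X rat_fps_power rat_fps_uminus

text \<open>Iterates starting from 0 agree to growing order, so each coefficient becomes stationary.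
  Every coefficient of the limit is one of an iterate, which is why rationality passes to the
  limit.\<close>

lemma fps_contraction_fixpoint:
  fixes T :: "('i \<Rightarrow> complex fps) \<Rightarrow> 'i \<Rightarrow> complex fps"
  assumes contraction: "\<And>X Y n j. (\<And>i. agree n (X i) (Y i)) \<Longrightarrow> agree (Suc n) (T X j) (T Y j)"
    and rat: "\<And>X j. (\<And>i. X i \<in> rat_fps) \<Longrightarrow> T X j \<in> rat_fps"
  obtains X where "T X = X" "\<And>i. X i \<in> rat_fps"
proof -
  define S where "S = (\<lambda>n. (T ^^ n) (\<lambda>_. 0))"
  have S_Suc: "S (Suc n) = T (S n)" for n by (simp add: S_def)
  have step: "agree n (S n i) (S (Suc n) i)" for n i
  proof (induction n arbitrary: i)
    case 0
    show ?case by (simp add: agree_def)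
  next
    case (Suc n)
    then show ?case using contraction[of n "S n" "S (Suc n)"] by (simp add: S_Suc)
  qed
  have later: "S (m + d) i $ j = S m i $ j" if "j < m" for m d i j
    using that
  proof (induction d)
    case (Suc d)
    then show ?case using step[of "m + d" i] by (simp add: agree_def)
  qed simp
  \<comment> \<open>From iterate j + 1 on, the coefficient of index j no longer changes.\<close>
  define L where "L = (\<lambda>i. Abs_fps (\<lambda>j. S (Suc j) i $ j))"
  have L: "agree n (L i) (S n i)" for n i
    unfolding agree_def
  proof (intro allI impI)
    fix j assume "j < n"
    then show "L i $ j = S n i $ j"
      using later[of j "Suc j" "n - Suc j" i] by (simp add: L_def)
  qed
  have "T L i $ j = L i $ j" for i j
  proof -
    have "agree (Suc j) (T L i) (T (S j) i)" by (rule contraction) (rule L)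
    then show ?thesis using L[of "Suc j" i] by (simp add: agree_def S_Suc)
  qed
  then have "T L = L" by (intro ext fps_ext)
  moreover have "S n i \<in> rat_fps" for n i
  proof (induction n arbitrary: i)
    case 0
    show ?case by (simp add: S_def rat_fps_def)
  next
    case (Suc n)
    then show ?case unfolding S_Suc by (rule rat)
  qed
  then have "L i \<in> rat_fps" for i
    by (simp add: L_def rat_fps_def)
  ultimately show ?thesis using that by blast
qed

section \<open>Descent from complex to integer coefficients along a rational branch\<close>

text \<open>The Q-line through \<open>c\<close> has a complement in C as a vector space over
  Q.\<close>

lemma rational_functional:
  fixes c :: complex
  assumes "c \<noteq> 0"
  obtains \<phi> :: "complex \<Rightarrow> rat" where "\<And>x y. \<phi> (x + y) = \<phi> x + \<phi> y"
    "\<And>q x. \<phi> (of_rat q * x) = q * \<phi> x" "\<phi> c = 1"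
proof -
  interpret vector_space_pair "\<lambda>q x. of_rat q * x :: complex" "(*) :: rat \<Rightarrow> rat \<Rightarrow> rat"
    by unfold_locales (simp_all add: algebra_simps of_rat_add of_rat_mult)
  have "vs1.independent {c}" using assms by (simp add: vs1.dependent_single)
  from linear_independent_extend[OF this, of "\<lambda>_. 1"] obtain g
    where g: "Vector_Spaces.linear (\<lambda>q x. of_rat q * x :: complex) (*) g" "g c = 1" by auto
  interpret g: Vector_Spaces.linear "\<lambda>q x. of_rat q * x :: complex" "(*)" g by fact
  show ?thesis using that[of g] g.add g.scale g(2) by blast
qed

lemma common_denominator:
  fixes S :: "rat set"
  assumes "finite S"
  obtains N :: int where "N > 0" "\<And>q. q \<in> S \<Longrightarrow> of_int N * q \<in> \<int>"
proof -
  have "\<exists>N::int. N > 0 \<and> (\<forall>q\<in>S. of_int N * q \<in> \<int>)"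
    using assms
  proof (induction S)
    case empty
    show ?case by (intro exI[of _ 1]) simp
  next
    case (insert q S)
    then obtain N :: int where N: "N > 0" "\<forall>q\<in>S. of_int N * q \<in> \<int>" by blast
    obtain a b where ab: "quotient_of q = (a, b)" by fastforce
    have b: "b > 0" "q = of_int a / of_int b"
      using quotient_of_denom_pos[OF ab] quotient_of_div[OF ab] by auto
    have "of_int (N * b) * q = of_int (N * a)" using b by simp
    then have "of_int (N * b) * q \<in> \<int>" by (metis Ints_of_int)
    moreover have "of_int (N * b) * r \<in> \<int>" if "r \<in> S" for r
    proof -
      have "of_int (N * b) * r = of_int b * (of_int N * r)" by simp
      also have "\<dots> \<in> \<int>" using N(2) that by (blast intro: Ints_mult[OF Ints_of_int])
      finally show ?thesis .
    qed
    ultimately show ?case using N(1) b(1) by (intro exI[of _ "N * b"]) auto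
  qed
  with that show ?thesis by blast
qed

lemma eval_hom_sum:
  assumes h: "is_hom h" and n: "degree p \<le> n"
  shows "eval_hom h x p = (\<Sum>i\<le>n. h (coeff p i) * x ^ i)"
proof -
  have c: "coeff (map_poly h p) i = h (coeff p i)" for i
    by (simp add: coeff_map_poly is_hom_0[OF h])
  have "eval_hom h x p = (\<Sum>i\<le>degree (map_poly h p). coeff (map_poly h p) i * x ^ i)"
    by (simp add: eval_hom_def poly_altdef)
  also have "\<dots> = (\<Sum>i\<le>n. coeff (map_poly h p) i * x ^ i)"
    using n map_poly_degree_leq[of h p]
    by (intro sum.mono_neutral_left) (auto simp: coeff_eq_0)
  finally show ?thesis by (simp add: c)
qed

definition eval2 :: "('a::comm_ring_1 \<Rightarrow> 'b::comm_ring_1) \<Rightarrow> 'b \<Rightarrow> 'b \<Rightarrow> 'a poly poly \<Rightarrow> 'b" where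
  "eval2 h a u = eval_hom (eval_hom h a) u"

lemma is_hom_eval2: "is_hom h \<Longrightarrow> is_hom (eval2 h a u)"
  unfolding eval2_def by (intro is_hom_eval_hom)

definition complex_pp :: "int poly poly \<Rightarrow> complex poly poly" where
  "complex_pp = map_poly (map_poly of_int)"

lemma eval_hom_map_poly:
  "g 0 = 0 \<Longrightarrow> h 0 = 0 \<Longrightarrow> eval_hom h x (map_poly g p) = eval_hom (\<lambda>c. h (g c)) x p"
  by (simp add: eval_hom_def map_poly_map_poly o_def)

lemma eval2_complex_pp:
  fixes h :: "complex \<Rightarrow> 'a::comm_ring_1"
  assumes h: "is_hom h"
  shows "eval2 h a u (complex_pp F) = eval2 of_int a u F"
proof -
  have "(\<lambda>c. h (of_int c)) = of_int" by (simp add: is_hom_of_int[OF h])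
  then show ?thesis
    by (simp add: eval2_def complex_pp_def eval_hom_map_poly is_hom_0[OF h])
qed

text \<open>1/X is transcendental over Z: the pole of highest order carries the leading
  coefficient.\<close>

lemma eval_hom_fls_X_inv_eq_0_imp:
  fixes r :: "int poly"
  assumes "eval_hom (of_int :: int \<Rightarrow> complex fls) fls_X_inv r = 0"
  shows "r = 0"
proof -
  have "0 = (\<Sum>i\<le>degree r. of_int (coeff r i) * fls_X_inv ^ i :: complex fls) $$ (- int (degree r))"
    using assms eval_hom_sum[OF is_hom_of_int_fun le_refl, of fls_X_inv r] by (metis fls_zero_nth)
  also have "\<dots> = (\<Sum>i\<le>degree r. if i = degree r then of_int (coeff r i) else 0)"
    unfolding fls_nth_sum by (intro sum.cong) simp_all
  also have "\<dots> = of_int (lead_coeff r)" by simp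
  finally show ?thesis by simp
qed

text \<open>Otherwise some combination of \<open>F\<close> and \<open>G\<close> is a nonzero
  polynomial in a alone, which would vanish at a = 1/X.\<close>

lemma branch_dvd_int:
  fixes F G :: "int poly poly"
  assumes F: "prime_elem F" "degree F > 0"
    and F0: "eval2 of_int (fls_X_inv :: complex fls) U F = 0"
    and G0: "eval2 of_int (fls_X_inv :: complex fls) U G = 0"
  shows "F dvd G"
proof (rule ccontr)
  assume "\<not> F dvd G"
  with F obtain \<alpha> \<gamma> r where r: "\<alpha> * F + \<gamma> * G = [:r:]" "r \<noteq> 0" by (rule prime_elem_bezout)
  have hom: "is_hom (eval2 (of_int :: int \<Rightarrow> complex fls) fls_X_inv U)"
    by (intro is_hom_eval2 is_hom_of_int_fun)
  have "eval2 of_int (fls_X_inv :: complex fls) U [:r:] = 0"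
    unfolding r(1)[symmetric] by (simp add: is_hom_simps[OF hom] F0 G0)
  then have "eval_hom (of_int :: int \<Rightarrow> complex fls) fls_X_inv r = 0"
    by (simp add: eval2_def eval_hom_pCons is_hom_eval_hom is_hom_of_int_fun)
  with eval_hom_fls_X_inv_eq_0_imp r(2) show False by blast
qed

lemma eval2_fls_nth:
  fixes h :: "'a::comm_ring_1 \<Rightarrow> complex fls"
  assumes h: "is_hom h" "\<And>c. h c = fls_const (g c)"
    and n: "degree p \<le> n" "\<And>i. degree (coeff p i) \<le> m"
  shows "eval2 h a u p $$ N = (\<Sum>i\<le>n. \<Sum>j\<le>m. g (coeff (coeff p i) j) * (a ^ j * u ^ i) $$ N)"
proof -
  have "eval2 h a u p = (\<Sum>i\<le>n. \<Sum>j\<le>m. fls_const (g (coeff (coeff p i) j)) * (a ^ j * u ^ i))"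
    unfolding eval2_def
    by (simp add: eval_hom_sum[OF is_hom_eval_hom[OF h(1)] n(1)] eval_hom_sum[OF h(1) n(2)]
        h(2) sum_distrib_right mult.assoc)
  then show ?thesis by (simp add: fls_nth_sum)
qed

lemma rational_branch_power_nth:
  assumes "w \<in> rat_fps"
  shows "(fls_X_inv ^ j * (fps_to_fls w * fls_X_inv) ^ i) $$ N \<in> \<rat>"
proof -
  have "fls_X_inv ^ j * (fps_to_fls w * fls_X_inv) ^ i = fls_X_inv ^ (j + i) * fps_to_fls (w ^ i)"
    by (simp add: power_mult_distrib power_add fps_to_fls_power ac_simps)
  also have "\<dots> = fls_shift (j + i) (fps_to_fls (w ^ i))"
    by (simp add: fls_X_inv_power_times_conv_shift)
  finally show ?thesis using rat_fps_power[OF assms, of i] by (simp add: rat_fps_def)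
qed

text \<open>Each Laurent coefficient of the evaluated polynomial is a linear form in the
  coefficients of \<open>p\<close>, with rational weights. A Q-linear functional applied to all
  coefficients of \<open>p\<close> therefore preserves vanishing on the branch. Choosing it to be 1
  on a nonzero coefficient keeps the result nonzero.\<close>

lemma branch_no_small_degree:
  fixes F :: "int poly poly" and p :: "complex poly poly"
  assumes F: "prime_elem F" "degree F > 0"
    and w: "w \<in> rat_fps"
    and F0: "eval2 of_int fls_X_inv (fps_to_fls w * fls_X_inv) F = 0"
    and p0: "eval2 fls_const fls_X_inv (fps_to_fls w * fls_X_inv) p = 0"
    and deg: "degree p < degree F"
  shows "p = 0"
proof (rule ccontr)
  assume "p \<noteq> 0"
  then obtain i0 j0 where c: "coeff (coeff p i0) j0 \<noteq> 0"
    by (metis leading_coeff_0_iff)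
  obtain \<phi> :: "complex \<Rightarrow> rat" where \<phi>: "\<And>x y. \<phi> (x + y) = \<phi> x + \<phi> y"
    "\<And>q x. \<phi> (of_rat q * x) = q * \<phi> x" "\<phi> (coeff (coeff p i0) j0) = 1"
    using rational_functional[OF c] by metis
  have \<phi>0: "\<phi> 0 = 0" using \<phi>(2)[of 0 0] by simp
  have \<phi>sum: "\<phi> (\<Sum>x\<in>A. f x) = (\<Sum>x\<in>A. \<phi> (f x))" for A :: "nat set" and f
    by (induction A rule: infinite_finite_induct) (simp_all add: \<phi>0 \<phi>(1))
  define m where "m = (MAX i\<in>{..degree p}. degree (coeff p i))"
  have m: "degree (coeff p i) \<le> m" for i
  proof (cases "i \<le> degree p")
    case True
    then show ?thesis unfolding m_def by (intro Max_ge) auto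
  qed (simp add: coeff_eq_0)
  \<comment> \<open>Zero accounts for the coefficients outside the finite index range.\<close>
  define S where "S = insert 0 ((\<lambda>(i, j). \<phi> (coeff (coeff p i) j)) ` ({..degree p} \<times> {..m}))"
  have "finite S" by (simp add: S_def)
  then obtain N :: int where N: "N > 0" "\<And>q. q \<in> S \<Longrightarrow> of_int N * q \<in> \<int>"
    by (rule common_denominator) blast
  have inS: "\<phi> (coeff (coeff p i) j) \<in> S" for i j
  proof (cases "i \<le> degree p \<and> j \<le> m")
    case False
    then have "coeff (coeff p i) j = 0"
      using m[of i] by (metis coeff_0 coeff_eq_0 linorder_not_less order.strict_trans1)
    then show ?thesis by (simp add: S_def \<phi>0)
  qed (auto simp: S_def)
  \<comment> \<open>On the coefficients of \<open>p\<close> the product is already an integer; the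
    floor only turns it into an \<open>int\<close>.\<close>
  define \<psi> where "\<psi> = (\<lambda>c. \<lfloor>of_int N * \<phi> c\<rfloor>)"
  have \<psi>0: "\<psi> 0 = 0" by (simp add: \<psi>_def \<phi>0)
  define \<rho> where "\<rho> = map_poly (map_poly \<psi>) p"
  have coeff_\<rho>: "coeff (coeff \<rho> i) j = \<psi> (coeff (coeff p i) j)" for i j
    by (simp add: \<rho>_def coeff_map_poly \<psi>0)
  have \<psi>: "of_int (\<psi> (coeff (coeff p i) j)) = of_int N * \<phi> (coeff (coeff p i) j)" for i j
    using N(2)[OF inS[of i j]] by (auto simp: \<psi>_def elim: Ints_cases)
  have "\<rho> \<noteq> 0"
    using coeff_\<rho>[of i0 j0] \<psi>[of i0 j0] \<phi>(3) N(1) by auto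
  have deg_\<rho>: "degree \<rho> \<le> degree p"
    unfolding \<rho>_def by (rule map_poly_degree_leq)
  have deg_\<rho>_coeff: "degree (coeff \<rho> i) \<le> m" for i
    using m[of i] map_poly_degree_leq[of \<psi> "coeff p i"] by (simp add: \<rho>_def coeff_map_poly \<psi>0)
  have "eval2 of_int fls_X_inv (fps_to_fls w * fls_X_inv) \<rho> $$ M = 0" for M
  proof -
    let ?e = "\<lambda>i j. (fls_X_inv ^ j * (fps_to_fls w * fls_X_inv) ^ i) $$ M"
    have "\<exists>q. ?e i j = of_rat q" for i j
      using rational_branch_power_nth[OF w] by (metis Rats_cases)
    then obtain q where q: "\<And>i j. ?e i j = of_rat (q i j)"
      using that[of "\<lambda>i j. SOME q. ?e i j = of_rat q"] someI_ex by fast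
    have "(\<Sum>i\<le>degree p. \<Sum>j\<le>m. of_rat (q i j) * coeff (coeff p i) j) = 0"
      using eval2_fls_nth[OF is_hom_fls_const, of "\<lambda>c. c" p "degree p" m fls_X_inv
          "fps_to_fls w * fls_X_inv" M, OF refl le_refl m]
      unfolding p0 q by (simp add: mult.commute)
    then have "\<phi> (\<Sum>i\<le>degree p. \<Sum>j\<le>m. of_rat (q i j) * coeff (coeff p i) j) = 0"
      by (simp add: \<phi>0)
    then have *: "(\<Sum>i\<le>degree p. \<Sum>j\<le>m. q i j * \<phi> (coeff (coeff p i) j)) = 0"
      by (simp add: \<phi>sum \<phi>(2))
    have "eval2 of_int fls_X_inv (fps_to_fls w * fls_X_inv) \<rho> $$ M
        = (\<Sum>i\<le>degree p. \<Sum>j\<le>m. of_int (coeff (coeff \<rho> i) j) * ?e i j)"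
      by (rule eval2_fls_nth[OF is_hom_of_int_fun]) (auto simp: fls_of_int deg_\<rho> deg_\<rho>_coeff)
    also have "\<dots> = (\<Sum>i\<le>degree p. \<Sum>j\<le>m. of_rat (of_int N * (q i j * \<phi> (coeff (coeff p i) j))))"
    proof (intro sum.cong refl)
      fix i j
      have "of_int (coeff (coeff \<rho> i) j) = (of_rat (of_int (\<psi> (coeff (coeff p i) j))) :: complex)"
        by (simp add: coeff_\<rho>)
      then show "of_int (coeff (coeff \<rho> i) j) * ?e i j
          = of_rat (of_int N * (q i j * \<phi> (coeff (coeff p i) j)))"
        unfolding q by (simp only: \<psi> of_rat_mult ac_simps)
    qed
    also have "\<dots> = of_rat (of_int N * (\<Sum>i\<le>degree p. \<Sum>j\<le>m. q i j * \<phi> (coeff (coeff p i) j)))"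
      by (simp only: sum_distrib_left of_rat_sum)
    finally show ?thesis by (simp add: *)
  qed
  then have "eval2 of_int fls_X_inv (fps_to_fls w * fls_X_inv) \<rho> = 0"
    by (intro fls_eqI) simp
  from branch_dvd_int[OF F F0 this] have "degree F \<le> degree \<rho>"
    using \<open>\<rho> \<noteq> 0\<close> by (rule dvd_imp_degree_le)
  with deg deg_\<rho> show False by simp
qed

lemma coeff_complex_pp: "coeff (complex_pp F) i = map_poly of_int (coeff F i)"
  by (simp add: complex_pp_def coeff_map_poly)

lemma degree_complex_pp: "degree (complex_pp F) = degree F"
proof (rule antisym)
  show "degree (complex_pp F) \<le> degree F"
    unfolding complex_pp_def by (rule map_poly_degree_leq)
  show "degree F \<le> degree (complex_pp F)"
  proof (cases "F = 0")
    case False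
    then obtain j where "coeff (lead_coeff F) j \<noteq> 0" by (metis leading_coeff_0_iff)
    then have "coeff (coeff (complex_pp F) (degree F)) j \<noteq> 0"
      by (simp add: coeff_complex_pp coeff_map_poly)
    then show ?thesis by (intro le_degree) auto
  qed simp
qed

lemma complex_pp_branch_dvd:
  assumes F: "prime_elem F" "degree F > 0" "lead_coeff F = 1"
    and w: "w \<in> rat_fps"
    and F0: "eval2 of_int fls_X_inv (fps_to_fls w * fls_X_inv) F = 0"
  shows "complex_pp F dvd p \<longleftrightarrow> eval2 fls_const fls_X_inv (fps_to_fls w * fls_X_inv) p = 0"
proof -
  define ev where "ev = eval2 fls_const fls_X_inv (fps_to_fls w * fls_X_inv)"
  have hom: "is_hom ev" unfolding ev_def by (intro is_hom_eval2 is_hom_fls_const)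
  have F0': "ev (complex_pp F) = 0"
    unfolding ev_def using F0 eval2_complex_pp[OF is_hom_fls_const] by metis
  have "complex_pp F dvd p" if p0: "ev p = 0"
  proof -
    have "lead_coeff (complex_pp F) = 1"
      by (simp add: degree_complex_pp coeff_complex_pp F(3))
    then obtain q r where qr: "p = complex_pp F * q + r" "r = 0 \<or> degree r < degree (complex_pp F)"
      by (rule monic_division)
    have "ev r = 0" using p0 unfolding qr(1) by (simp add: is_hom_simps[OF hom] F0')
    then have "r = 0"
      using branch_no_small_degree[OF F(1,2) w F0, of r] qr(2) F(2)
      by (auto simp: degree_complex_pp ev_def)
    then show ?thesis using qr(1) by simp
  qed
  moreover have "ev p = 0" if "complex_pp F dvd p"
    using that by (auto simp: is_hom_simps[OF hom] F0')
  ultimately show ?thesis unfolding ev_def by blast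
qed

text \<open>The multiples of \<open>F\<close> are the kernel of a homomorphism into Laurent series
  over C, a ring without zero divisors.\<close>

lemma prime_elem_complex_pp:
  assumes F: "prime_elem F" "degree F > 0" "lead_coeff F = 1"
    and w: "w \<in> rat_fps"
    and F0: "eval2 of_int fls_X_inv (fps_to_fls w * fls_X_inv) F = 0"
  shows "prime_elem (complex_pp F)"
proof (rule prime_elemI)
  have deg: "degree (complex_pp F) > 0" using F(2) by (simp add: degree_complex_pp)
  then show "complex_pp F \<noteq> 0" by auto
  show "\<not> complex_pp F dvd 1" using deg dvd_imp_degree_le[of "complex_pp F" 1] by auto
  fix p q assume "complex_pp F dvd p * q"
  then show "complex_pp F dvd p \<or> complex_pp F dvd q"
    unfolding complex_pp_branch_dvd[OF F w F0]
    by (simp add: is_hom_mult[OF is_hom_eval2[OF is_hom_fls_const]])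
qed

end

section \<open>The critical orbit\<close>

text \<open>The second argument is \<open>u = b - a\<close>.\<close>

fun crit_orbit :: "'a::idom \<Rightarrow> 'a \<Rightarrow> nat \<Rightarrow> 'a" where
  "crit_orbit a u 0 = a"
| "crit_orbit a u (Suc n) =
     crit_orbit a u n ^ 3 - 3 * a ^ 2 * crit_orbit a u n + 2 * a ^ 3 + (a + u)"

text \<open>The difference quotient (f(y) - f(x)) / (y - x) at x = x_n, y = x_(n+1). If it vanishes,
  x_(n+1) = x_(n+2), so the orbit reaches a fixed point.\<close>

definition preper1_poly :: "'a::idom \<Rightarrow> 'a \<Rightarrow> nat \<Rightarrow> 'a" where
  "preper1_poly a u n = crit_orbit a u n ^ 2 + crit_orbit a u n * crit_orbit a u (Suc n)
     + crit_orbit a u (Suc n) ^ 2 - 3 * a ^ 2"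

text \<open>The same difference quotient at x_n and x_(n+2): if it vanishes, both have the same
  image.\<close>

definition collision_poly :: "'a::idom \<Rightarrow> 'a \<Rightarrow> nat \<Rightarrow> 'a" where
  "collision_poly a u n = crit_orbit a u n ^ 2 + crit_orbit a u n * crit_orbit a u (Suc (Suc n))
     + crit_orbit a u (Suc (Suc n)) ^ 2 - 3 * a ^ 2"

text \<open>The quotient of the collision polynomial by the preceding one (see \<open>collision_poly_factor\<close>):
  dividing removes the parameters for which the critical point lands on a fixed point.\<close>

definition preper2_poly :: "'a::idom \<Rightarrow> 'a \<Rightarrow> nat \<Rightarrow> 'a" where
  "preper2_poly a u n = 1 + (crit_orbit a u (Suc n) - crit_orbit a u n)
     * (crit_orbit a u n + crit_orbit a u (Suc n) + crit_orbit a u (Suc (Suc n)))"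

text \<open>By \<open>crit_orbit_2\<close>, this vanishes exactly when \<open>a\<close> has period 2.\<close>

definition period2_poly :: "'a::idom \<Rightarrow> 'a \<Rightarrow> 'a" where
  "period2_poly a u = 1 + u * (u + 3 * a)"

text \<open>The orbit is defined over every integral domain, so one integral polynomial governs the
  complex points as well as the Laurent branch.\<close>

lemma hom_crit_orbit: "is_hom h \<Longrightarrow> h (crit_orbit a u n) = crit_orbit (h a) (h u) n"
  by (induction n) (simp_all add: is_hom_simps)

lemma hom_preper2_poly: "is_hom h \<Longrightarrow> h (preper2_poly a u n) = preper2_poly (h a) (h u) n"
  by (simp add: preper2_poly_def is_hom_simps hom_crit_orbit del: crit_orbit.simps)

lemma hom_period2_poly: "is_hom h \<Longrightarrow> h (period2_poly a u) = period2_poly (h a) (h u)"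
  by (simp add: period2_poly_def is_hom_simps)

lemma crit_orbit_step:
  "crit_orbit a u (Suc (Suc n)) - crit_orbit a u (Suc n)
    = (crit_orbit a u (Suc n) - crit_orbit a u n) * preper1_poly a u n"
proof -
  have "crit_orbit a u (Suc (Suc n)) - crit_orbit a u (Suc n)
      = (crit_orbit a u (Suc n) ^ 3 - 3 * a ^ 2 * crit_orbit a u (Suc n))
        - (crit_orbit a u n ^ 3 - 3 * a ^ 2 * crit_orbit a u n)"
    by (simp only: crit_orbit.simps) simp
  also have "\<dots> = (crit_orbit a u (Suc n) - crit_orbit a u n) * preper1_poly a u n"
    unfolding preper1_poly_def by algebra
  finally show ?thesis .
qed

lemma crit_orbit_two_step:
  "crit_orbit a u (Suc (Suc (Suc n))) - crit_orbit a u (Suc n)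
    = (crit_orbit a u (Suc (Suc n)) - crit_orbit a u n) * collision_poly a u n"
proof -
  have "crit_orbit a u (Suc (Suc (Suc n))) - crit_orbit a u (Suc n)
      = (crit_orbit a u (Suc (Suc n)) ^ 3 - 3 * a ^ 2 * crit_orbit a u (Suc (Suc n)))
        - (crit_orbit a u n ^ 3 - 3 * a ^ 2 * crit_orbit a u n)"
    by (simp only: crit_orbit.simps) simp
  also have "\<dots> = (crit_orbit a u (Suc (Suc n)) - crit_orbit a u n) * collision_poly a u n"
    unfolding collision_poly_def by algebra
  finally show ?thesis .
qed

text \<open>For x, y, z = x_n, x_(n+1), x_(n+2) the two difference quotients differ by (z - y)(x + y
  + z), and z - y is itself (y - x) times \<open>preper1_poly\<close>.\<close>

lemma collision_poly_factor: "collision_poly a u n = preper1_poly a u n * preper2_poly a u n"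
  using crit_orbit_step[of a u n]
  unfolding collision_poly_def preper1_poly_def preper2_poly_def by algebra

lemma crit_orbit_Suc_0: "crit_orbit a u (Suc 0) = a + u"
  by (simp add: algebra_simps power3_eq_cube power2_eq_square)

text \<open>f(x) - f(a) has a double zero at the critical point a and a simple one at -2a. The
  double zero squares errors near a; both zeros shape the branch at infinity.\<close>

lemma crit_orbit_Suc_alt:
  "crit_orbit a u (Suc n) = (crit_orbit a u n - a) ^ 2 * (crit_orbit a u n + 2 * a) + a + u"
  unfolding crit_orbit.simps by algebra

lemma crit_orbit_2: "crit_orbit a u (Suc (Suc 0)) = a + u * period2_poly a u"
  unfolding crit_orbit_Suc_alt[of a u "Suc 0"] crit_orbit_Suc_0 period2_poly_def by algebra

text \<open>Modulo E the orbit alternates between a and a + u. An error of order E at a becomes one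
  of order E^2 after the next step, since a is critical, so the first-order term u E at even indices
  is the same for all j.\<close>

lemma crit_orbit_mod_period2_squared:
  "\<exists>s t. crit_orbit a u (2 * j + 2) = a + u * period2_poly a u + period2_poly a u ^ 2 * s \<and>
     crit_orbit a u (2 * j + 3) = a + u + period2_poly a u ^ 2 * t"
proof (induction j)
  case 0
  have "crit_orbit a u (Suc (Suc 0)) = a + u * period2_poly a u + period2_poly a u ^ 2 * 0"
    using crit_orbit_2[of a u] by simp
  moreover have "crit_orbit a u (Suc (Suc (Suc 0)))
      = a + u + period2_poly a u ^ 2 * (u ^ 2 * (3 * a + u * period2_poly a u))"
    unfolding crit_orbit_Suc_alt[of a u "Suc (Suc 0)"] crit_orbit_2 by algebra
  ultimately show ?case by (metis add_0 mult_zero_right numeral_2_eq_2 numeral_3_eq_3)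
next
  case (Suc j)
  define E where "E = period2_poly a u"
  obtain t where t: "crit_orbit a u (2 * j + 3) = a + u + E ^ 2 * t"
    using Suc unfolding E_def by blast
  have E: "E = 1 + u * (u + 3 * a)" by (simp add: E_def period2_poly_def)
  \<comment> \<open>With d = E^2 t this is (f(a + u + d) - f(a + u)) / E^2, while f(a + u) = a + u E
    is the second orbit point.\<close>
  let ?s = "t * (3 * (a + u) ^ 2 + 3 * (a + u) * (E ^ 2 * t) + (E ^ 2 * t) ^ 2 - 3 * a ^ 2)"
  have s: "crit_orbit a u (Suc (2 * j + 3)) = a + u * E + E ^ 2 * ?s"
    unfolding crit_orbit_Suc_alt[of a u "2 * j + 3"] t using E by algebra
  have "crit_orbit a u (Suc (Suc (2 * j + 3)))
      = a + u + E ^ 2 * ((u + E * ?s) ^ 2 * (3 * a + u * E + E ^ 2 * ?s))"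
    unfolding crit_orbit_Suc_alt[of a u "Suc (2 * j + 3)"] s by algebra
  moreover have "Suc (2 * j + 3) = 2 * Suc j + 2" "Suc (Suc (2 * j + 3)) = 2 * Suc j + 3" by simp_all
  ultimately show ?case using s unfolding E_def by metis
qed

text \<open>Modulo E one has x_n = x_(n+2) = a + u and x_(n+1) = a, so R becomes 1 - u (3a + 2u).
  Subtracting E leaves a multiple of 3.\<close>

lemma preper2_poly_mod_period2_odd:
  "\<exists>s. preper2_poly a u (2 * j + 1) = period2_poly a u * s + 3 * (- (u ^ 2) - 2 * a * u)"
proof -
  define E where "E = period2_poly a u"
  have E: "E = 1 + u * (u + 3 * a)" by (simp add: E_def period2_poly_def)
  have "\<exists>t. crit_orbit a u (2 * j + 1) = a + u + E * t"
  \<comment> \<open>The congruences modulo E^2 cover odd indices only from 3 on, so x_1 is treated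
    apart.\<close>
  proof (cases j)
    case 0
    have "crit_orbit a u (2 * j + 1) = a + u + E * 0" using 0 crit_orbit_Suc_0[of a u] by simp
    then show ?thesis by blast
  next
    case (Suc i)
    have "2 * j + 1 = 2 * i + 3" by (simp add: Suc)
    with crit_orbit_mod_period2_squared[of a u i] obtain t
      where "crit_orbit a u (2 * j + 1) = a + u + E ^ 2 * t" unfolding E_def by metis
    then have "crit_orbit a u (2 * j + 1) = a + u + E * (E * t)"
      by (simp add: power2_eq_square mult.assoc)
    then show ?thesis by blast
  qed
  then obtain t where t: "crit_orbit a u (2 * j + 1) = a + u + E * t" by blast
  have ix: "Suc (2 * j + 1) = 2 * j + 2" "Suc (2 * j + 2) = 2 * j + 3" by simp_all
  obtain s r where sr: "crit_orbit a u (2 * j + 2) = a + u * E + E ^ 2 * s"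
    "crit_orbit a u (2 * j + 3) = a + u + E ^ 2 * r"
    using crit_orbit_mod_period2_squared[of a u j] unfolding E_def by blast
  let ?p = "u + E * s - t" and ?q = "t + u + E * s + E * r"
  have "preper2_poly a u (2 * j + 1) = 1 + (E * ?p - u) * (3 * a + 2 * u + E * ?q)"
    unfolding preper2_poly_def ix t sr by algebra
  also have "\<dots> = E * (?p * (3 * a + 2 * u + E * ?q) - u * ?q + 1) + 3 * (- (u ^ 2) - 2 * a * u)"
    using E by algebra
  finally show ?thesis unfolding E_def by blast
qed

text \<open>Here x_n and x_(n+2) are a modulo E, so R is 1 + u (3a + u) = 0 modulo E. The quotient F
  is not found from R modulo E^2, but by cancelling E in the factorization of
  \<open>collision_poly\<close>: modulo E the factor \<open>preper1_poly\<close> is -1, while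
  \<open>collision_poly\<close> is 6 a u E modulo E^2.\<close>

lemma preper2_poly_mod_period2_even:
  fixes a u :: "'a::idom"
  assumes "period2_poly a u \<noteq> 0"
  shows "\<exists>F s. preper2_poly a u (2 * j + 2) = period2_poly a u * F \<and>
     F = period2_poly a u * s + 3 * (- 2 * a * u)"
proof -
  define E where "E = period2_poly a u"
  have E: "E = 1 + u * (u + 3 * a)" by (simp add: E_def period2_poly_def)
  have ix: "Suc (2 * j + 2) = 2 * j + 3" "Suc (2 * j + 3) = 2 * Suc j + 2" by simp_all
  obtain s r where sr: "crit_orbit a u (2 * j + 2) = a + u * E + E ^ 2 * s"
    "crit_orbit a u (2 * j + 3) = a + u + E ^ 2 * r"
    using crit_orbit_mod_period2_squared[of a u j] unfolding E_def by blast
  obtain t where t: "crit_orbit a u (2 * Suc j + 2) = a + u * E + E ^ 2 * t"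
    using crit_orbit_mod_period2_squared[of a u "Suc j"] unfolding E_def by blast
  let ?y = "u + E * s" and ?z = "u + E * t"
  have xs: "crit_orbit a u (2 * j + 2) = a + E * ?y" "crit_orbit a u (2 * Suc j + 2) = a + E * ?z"
    unfolding sr t by algebra+
  define x where "x = E * r - ?y"
  have "preper2_poly a u (2 * j + 2) = 1 + (u + E * x) * (3 * a + u + E * (E * r + ?y + ?z))"
    unfolding preper2_poly_def ix xs sr(2) x_def by algebra
  also have "\<dots> = E * (1 + x * (3 * a + u + E * (E * r + ?y + ?z)) + u * (E * r + ?y + ?z))"
    using E by algebra
  finally obtain F where F: "preper2_poly a u (2 * j + 2) = E * F" by blast
  define p where "p = 1 + ?y * (2 * a + E * ?y + (a + u + E ^ 2 * r)) + (a * E * r + E * r * (2 * (a + u) + E ^ 2 * r))"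
  have P: "preper1_poly a u (2 * j + 2) = - 1 + E * p"
    unfolding preper1_poly_def ix xs sr(2) p_def using E by algebra
  define q where "q = 3 * a * (s + t) + ?y ^ 2 + ?y * ?z + ?z ^ 2"
  have Q: "collision_poly a u (2 * j + 2) = E * (6 * a * u + E * q)"
    unfolding collision_poly_def ix xs q_def by algebra
  have "E * ((- 1 + E * p) * F) = E * (6 * a * u + E * q)"
    using collision_poly_factor[of a u "2 * j + 2"] unfolding P Q F by (simp only: ac_simps)
  then have "(- 1 + E * p) * F = 6 * a * u + E * q" using assms unfolding E_def by simp
  then have "F = E * (p * F - q) + 3 * (- 2 * a * u)" by algebra
  with F show ?thesis unfolding E_def by blast
qed

section \<open>Congruences modulo 3\<close>

lemma dvd_diff_trans:
  fixes x y z :: "'a::comm_ring_1"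
  assumes "m dvd x - y" "m dvd y - z"
  shows "m dvd x - z"
  using dvd_add[OF assms] by simp

lemma dvd_diff_trans':
  fixes x y z :: "'a::comm_ring_1"
  assumes "m dvd x - y" "m dvd z - y"
  shows "m dvd x - z"
  using dvd_diff[OF assms] by simp

lemma dvd_power_diff:
  fixes x y :: "'a::comm_ring_1"
  assumes "m dvd x - y"
  shows "m dvd x ^ k - y ^ k"
proof (induction k)
  case (Suc k)
  have "x ^ Suc k - y ^ Suc k = x * (x ^ k - y ^ k) + (x - y) * y ^ k" by (simp add: algebra_simps)
  then show ?case using Suc assms by simp
qed simp

text \<open>Modulo 3 the difference f(y) - f(x) is (y - x)^3, and x_1 - x_0 = u.\<close>

lemma crit_orbit_diff_mod_3:
  "3 dvd (crit_orbit a u (Suc n) - crit_orbit a u n) - u ^ (3 ^ n)"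
proof (induction n)
  case 0
  show ?case unfolding crit_orbit_Suc_0 by simp
next
  case (Suc n)
  let ?d = "crit_orbit a u (Suc n) - crit_orbit a u n"
  have "(crit_orbit a u (Suc (Suc n)) - crit_orbit a u (Suc n)) - ?d ^ 3
      = 3 * (?d * (crit_orbit a u (Suc n) * crit_orbit a u n - a ^ 2))"
    unfolding crit_orbit_step preper1_poly_def by algebra
  then have "3 dvd (crit_orbit a u (Suc (Suc n)) - crit_orbit a u (Suc n)) - ?d ^ 3" by simp
  moreover have "3 dvd ?d ^ 3 - (u ^ (3 ^ n)) ^ 3" using Suc by (rule dvd_power_diff)
  ultimately have "3 dvd (crit_orbit a u (Suc (Suc n)) - crit_orbit a u (Suc n)) - (u ^ (3 ^ n)) ^ 3"
    by (rule dvd_diff_trans)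
  moreover have "(u ^ (3 ^ n)) ^ 3 = u ^ (3 ^ Suc n)" by (simp add: mult.commute flip: power_mult)
  ultimately show ?case by metis
qed

lemma frobenius_mod_3: "3 dvd (v + 1) ^ (3 ^ n) - (v ^ (3 ^ n) + (1 :: 'a::idom))"
proof (induction n)
  case (Suc n)
  let ?w = "v ^ (3 ^ n)"
  have e: "x ^ (3 ^ Suc n) = (x ^ (3 ^ n)) ^ 3" for x :: 'a
    by (simp add: mult.commute flip: power_mult)
  have "3 dvd ((v + 1) ^ (3 ^ n)) ^ 3 - (?w + 1) ^ 3" using Suc by (rule dvd_power_diff)
  moreover have "3 dvd (?w + 1) ^ 3 - (?w ^ 3 + 1)"
  proof -
    have "(?w + 1) ^ 3 - (?w ^ 3 + 1) = 3 * (?w ^ 2 + ?w)" by algebra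
    then show ?thesis by simp
  qed
  ultimately show ?case unfolding e by (rule dvd_diff_trans)
qed simp

text \<open>With d = x_(n+1) - x_n and d' = x_(n+2) - x_(n+1), the sum of the three orbit points is
  3 x_n + 2d + d', hence 2d + d^3 modulo 3. So R is 1 + 2d^2 + d^4, a square, and d is
  u^(3^n).\<close>

lemma preper2_poly_mod_3: "3 dvd preper2_poly a u n - (u ^ 2 + 1) ^ (2 * 3 ^ n)"
proof -
  define d where "d = crit_orbit a u (Suc n) - crit_orbit a u n"
  define d' where "d' = crit_orbit a u (Suc (Suc n)) - crit_orbit a u (Suc n)"
  define v where "v = u ^ (3 ^ n)"
  obtain x where x: "d' - d ^ 3 = 3 * x"
  proof -
    have "d' - d ^ 3 = 3 * (d * (crit_orbit a u (Suc n) * crit_orbit a u n - a ^ 2))"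
      unfolding d'_def crit_orbit_step preper1_poly_def d_def by algebra
    then show ?thesis by (rule that)
  qed
  have "preper2_poly a u n - (d ^ 2 + 1) ^ 2
      = 3 * (d * crit_orbit a u (Suc n) + d * x - d ^ 2)"
    using x unfolding preper2_poly_def d_def d'_def by algebra
  then have "3 dvd preper2_poly a u n - (d ^ 2 + 1) ^ 2" by simp
  moreover have "3 dvd (d ^ 2 + 1) ^ 2 - (v ^ 2 + 1) ^ 2"
  proof (rule dvd_power_diff)
    have "3 dvd d ^ 2 - v ^ 2" unfolding d_def v_def by (rule dvd_power_diff) (rule crit_orbit_diff_mod_3)
    then show "3 dvd d ^ 2 + 1 - (v ^ 2 + 1)" by simp
  qed
  ultimately have "3 dvd preper2_poly a u n - (v ^ 2 + 1) ^ 2" by (rule dvd_diff_trans)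
  moreover have "3 dvd ((u ^ 2 + 1) ^ (3 ^ n)) ^ 2 - (v ^ 2 + 1) ^ 2"
  proof (rule dvd_power_diff)
    have "v ^ 2 = (u ^ 2) ^ (3 ^ n)" unfolding v_def by (simp add: mult.commute flip: power_mult)
    then show "3 dvd (u ^ 2 + 1) ^ (3 ^ n) - (v ^ 2 + 1)"
      using frobenius_mod_3[of "u ^ 2" n] by simp
  qed
  ultimately have "3 dvd preper2_poly a u n - ((u ^ 2 + 1) ^ (3 ^ n)) ^ 2" by (rule dvd_diff_trans')
  moreover have "((u ^ 2 + 1) ^ (3 ^ n)) ^ 2 = (u ^ 2 + 1) ^ (2 * 3 ^ n)"
    by (simp add: mult.commute flip: power_mult)
  ultimately show ?thesis by simp
qed

section \<open>Irreducibility over the integers\<close>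

text \<open>Polynomials in \<open>a\<close> and \<open>u\<close> are polynomials in the outer variable \<open>u\<close> over those in \<open>a\<close>.\<close>

abbreviation a_var :: "'a::comm_ring_1 poly poly" where "a_var \<equiv> [:[:0, 1:]:]"

abbreviation u_var :: "'a::comm_ring_1 poly poly" where "u_var \<equiv> [:0, 1:]"

lemma degree_crit_orbit:
  "degree (crit_orbit a_var u_var (Suc n) :: int poly poly) = 3 ^ n \<and>
   lead_coeff (crit_orbit a_var u_var (Suc n) :: int poly poly) = 1"
proof (induction n)
  case 0
  show ?case unfolding crit_orbit_Suc_0 by simp
next
  case (Suc n)
  define x where "x = (crit_orbit a_var u_var (Suc n) :: int poly poly)"
  \<comment> \<open>All terms of the next orbit point except the cube, which dominates them in
    degree.\<close>
  define y :: "int poly poly" where "y = [:- 3 * [:0, 1:] ^ 2:] * x + [:2 * [:0, 1:] ^ 3 + [:0, 1:], 1:]"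
  have "crit_orbit a_var u_var (Suc (Suc n)) = y + x ^ 3"
    unfolding x_def y_def crit_orbit.simps(2)[of _ _ "Suc n"]
    by (simp add: numeral_poly algebra_simps power2_eq_square power3_eq_cube flip: smult_add_left del: crit_orbit.simps)
  moreover have x: "degree x = 3 ^ n" "lead_coeff x = 1" using Suc unfolding x_def by blast+
  have "degree y \<le> 3 ^ n"
    unfolding y_def
  proof (rule degree_add_le)
    show "degree ([:- 3 * [:0, 1:] ^ 2:] * x) \<le> 3 ^ n"
      using degree_mult_le[of "[:- 3 * [:0, 1:] ^ 2:]" x] x by simp
  qed simp
  then have "degree y < 3 ^ Suc n" by (rule order.strict_trans1) simp
  moreover have "degree (x ^ 3) = 3 ^ Suc n" using x by (subst degree_power_eq) auto
  moreover have "lead_coeff (x ^ 3) = 1" using x(2) by (simp only: lead_coeff_power power_one)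
  ultimately show ?case by (metis degree_add_eq_right lead_coeff_add_le)
qed

lemma degree_preper2_poly:
  assumes "n > 0"
  shows "degree (preper2_poly a_var u_var n :: int poly poly) = 4 * 3 ^ n"
    "lead_coeff (preper2_poly a_var u_var n :: int poly poly) = 1"
proof -
  obtain m where n: "n = Suc m" using assms gr0_implies_Suc by blast
  define x where "x = (crit_orbit a_var u_var :: nat \<Rightarrow> int poly poly)"
  have x: "degree (x (Suc j)) = 3 ^ j" "lead_coeff (x (Suc j)) = 1" for j
    using degree_crit_orbit[of j] unfolding x_def by blast+
  have top: "degree (q + p) = degree p \<and> lead_coeff (q + p) = lead_coeff p"
    if "degree q < degree p" for p q :: "int poly poly"
    using that by (simp add: degree_add_eq_right coeff_eq_0)
  have d1: "degree (- x n + x (Suc n)) = 3 ^ n \<and> lead_coeff (- x n + x (Suc n)) = 1"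
  proof -
    have "degree (- x n) < degree (x (Suc n))" using x(1)[of n] x(1)[of m] by (simp add: n)
    from top[OF this] x[of n] show ?thesis by metis
  qed
  have "degree (x n + x (Suc n)) \<le> 3 ^ n"
    using x(1)[of n] x(1)[of m] by (intro degree_add_le) (simp_all add: n)
  then have d2: "degree (x n + x (Suc n) + x (Suc (Suc n))) = 3 ^ Suc n \<and>
      lead_coeff (x n + x (Suc n) + x (Suc (Suc n))) = 1"
  proof -
    assume "degree (x n + x (Suc n)) \<le> 3 ^ n"
    then have "degree (x n + x (Suc n)) < degree (x (Suc (Suc n)))"
      unfolding x(1) by (rule order.strict_trans1) simp
    from top[OF this] x[of "Suc n"] show ?thesis by metis
  qed
  define p where "p = (- x n + x (Suc n)) * (x n + x (Suc n) + x (Suc (Suc n)))"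
  have "lead_coeff p = 1" unfolding p_def lead_coeff_mult by (metis d1 d2 mult_1)
  moreover have "degree p = 4 * 3 ^ n"
    unfolding p_def using d1 d2 by (subst degree_mult_eq) auto
  moreover have "preper2_poly a_var u_var n = 1 + p"
    unfolding preper2_poly_def p_def x_def by simp
  ultimately show "degree (preper2_poly a_var u_var n :: int poly poly) = 4 * 3 ^ n"
    "lead_coeff (preper2_poly a_var u_var n :: int poly poly) = 1"
    using top[of 1 p] by auto
qed

lemma period2_poly_vars: "period2_poly a_var u_var = ([:1, [:0, 3:], 1:] :: int poly poly)"
  by (simp add: period2_poly_def numeral_poly one_pCons)

lemma period2_poly_mod_3: "3 dvd period2_poly a_var u_var - ([:1, 0, 1:] :: int poly poly)"
proof -
  have "period2_poly a_var u_var - ([:1, 0, 1:] :: int poly poly) = 3 * [:0, [:0, 1:]:]"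
    by (simp add: period2_poly_vars numeral_poly)
  then show ?thesis by (metis dvd_triv_left)
qed

lemma preper2_poly_mod_3_period2:
  "3 dvd preper2_poly a_var u_var n - (period2_poly a_var u_var :: int poly poly) ^ (2 * 3 ^ n)"
proof -
  have "u_var ^ 2 + 1 = ([:1, 0, 1:] :: int poly poly)" by (simp add: power2_eq_square one_pCons)
  with preper2_poly_mod_3[of a_var "u_var :: int poly poly" n]
  have "3 dvd preper2_poly a_var u_var n - ([:1, 0, 1:] :: int poly poly) ^ (2 * 3 ^ n)" by simp
  then show ?thesis
    using dvd_power_diff[OF period2_poly_mod_3, of "2 * 3 ^ n"] by (rule dvd_diff_trans')
qed

text \<open>E = (u^2 + 1) + 3 a u, and a u lies outside the ideal.\<close>

lemma irreducible_period2_poly: "irreducible (period2_poly a_var u_var :: int poly poly)"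
proof (rule eisenstein_ideal3[of _ "[:1, 0, 1:]" 1 1 "[:0, [:0, 1:]:]"])
  show "3 dvd period2_poly a_var u_var - ([:1, 0, 1:] :: int poly poly) ^ 1"
    using period2_poly_mod_3 by simp
  show "period2_poly a_var u_var = ([:1, 0, 1:] * 1 + 3 * [:0, [:0, 1:]:] :: int poly poly)"
    by (simp add: period2_poly_vars numeral_poly)
  show "[:0, [:0, 1:]:] \<notin> ideal3"
    unfolding ideal3_linear_iff three_dvd_poly_iff by (auto intro: exI[of _ 1])
qed (simp_all add: period2_poly_vars)

text \<open>The index is n = k - 1. For odd n the criterion applies to R, with residue -u^2 - 2au;
  for even n it applies to R / E, with residue -2au.\<close>

lemma irreducible_preper2_factor:
  assumes "n > 0"
  obtains F :: "int poly poly" where "irreducible F" "lead_coeff F = 1" "degree F > 0"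
    "preper2_poly a_var u_var n = (if odd n then F else period2_poly a_var u_var * F)"
proof -
  define E where "E = (period2_poly a_var u_var :: int poly poly)"
  have E: "lead_coeff E = 1" "degree E = 2" "E \<noteq> 0"
    unfolding E_def period2_poly_vars by simp_all
  define R where "R = (preper2_poly a_var u_var n :: int poly poly)"
  note R_deg = degree_preper2_poly[OF assms, folded R_def]
  have R_mod_3: "3 dvd R - E ^ (2 * 3 ^ n)"
    unfolding R_def E_def by (rule preper2_poly_mod_3_period2)
  have E_mod_3: "3 dvd E - [:1, 0, 1:]" unfolding E_def by (rule period2_poly_mod_3)
  have not3: "\<not> 3 dvd (1 :: int poly)" "\<not> 3 dvd ([:0, - 2:] :: int poly)"
    unfolding three_dvd_poly_iff by (auto intro: exI[of _ 0] exI[of _ 1])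
  show ?thesis
  proof (cases "odd n")
    case True
    then obtain j where j: "n = 2 * j + 1" by (rule oddE)
    obtain s where s: "R = E * s + 3 * (- (u_var ^ 2) - 2 * a_var * u_var)"
      using preper2_poly_mod_period2_odd[of a_var u_var j] unfolding R_def E_def j by blast
    have "- (u_var ^ 2) - 2 * a_var * u_var \<notin> ideal3"
    proof
      assume "- (u_var ^ 2) - 2 * a_var * u_var \<in> ideal3"
      \<comment> \<open>Adding u^2 + 1 turns the residue into 1 - 2au, which has degree 1 and is
        decided coefficientwise.\<close>
      moreover have "[:1, 0, 1:] * 1 \<in> ideal3" by (rule ideal3_I[of _ 0 1]) simp
      ultimately have "- (u_var ^ 2) - 2 * a_var * u_var + [:1, 0, 1:] * 1 \<in> ideal3"
        by (rule ideal3_add)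
      moreover have "- (u_var ^ 2) - 2 * a_var * u_var + [:1, 0, 1:] * 1
          = ([:1, [:0, - 2:]:] :: int poly poly)"
        by (simp add: power2_eq_square numeral_poly)
      ultimately show False using not3 ideal3_linear_iff by metis
    qed
    then have "irreducible R"
      using eisenstein_ideal3[OF R_deg(2) _ E(1) E_mod_3 R_mod_3 s] R_deg(1) by simp
    then show ?thesis using True R_deg by (intro that[of R]) (simp_all add: R_def)
  next
    case False
    then obtain i where i: "n = 2 * i" by (auto elim: evenE)
    with assms obtain j' where "i = Suc j'" by (cases i) auto
    with i obtain j where j: "n = 2 * j + 2" by auto
    obtain F s where F: "R = E * F" "F = E * s + 3 * (- 2 * a_var * u_var)"
      using preper2_poly_mod_period2_even[of a_var u_var j] E(3) unfolding R_def E_def j by blast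
    have lc: "lead_coeff F = 1"
      using R_deg(2) E(1) unfolding F(1) lead_coeff_mult by simp
    have "F \<noteq> 0" using lc by auto
    then have "degree R = 2 + degree F" unfolding F(1) using E by (simp add: degree_mult_eq)
    moreover have "4 * 3 ^ n \<ge> (4 :: nat)" by simp
    ultimately have deg: "degree F > 0" using R_deg(1) by linarith
    have "- 2 * a_var * u_var = ([:0, [:0, - 2:]:] :: int poly poly)"
      by (simp add: numeral_poly)
    then have t: "- 2 * a_var * u_var \<notin> ideal3"
      using not3 ideal3_linear_iff by metis
    \<comment> \<open>One power of E is lost to the division.\<close>
    define N where "N = 2 * 3 ^ n - (1 :: nat)"
    have "2 * 3 ^ n = Suc N" unfolding N_def by simp
    with R_mod_3 have "3 dvd E * (F - E ^ N)" unfolding F(1) by (simp add: algebra_simps)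
    moreover have "\<not> 3 dvd E"
      using not3(1) E(1) unfolding three_dvd_poly_poly_iff by metis
    ultimately have "3 dvd F - E ^ N"
      using prime_elem_dvd_multD[OF prime_elem_3_int_poly_poly] by blast
    then have "irreducible F"
      using eisenstein_ideal3[OF lc deg E(1) E_mod_3 _ F(2) t] by blast
    then show ?thesis using False lc deg F(1) by (intro that[of F]) (simp_all add: R_def E_def)
  qed
qed

section \<open>A rational branch at infinity\<close>

lemma eval2_vars:
  assumes "is_hom h"
  shows "eval2 h a u a_var = a" "eval2 h a u u_var = u"
  using assms by (simp_all add: eval2_def eval_hom_pCons is_hom_eval_hom is_hom_0 is_hom_1)

context
  includes fps_syntax and no vec_syntax
begin

text \<open>With \<open>a = 1 / X\<close>, the ansatz for the orbit of \<open>a\<close> is \<open>f\<^sup>j(a) = (- 2 + X\<^sup>2 \<delta>\<^sub>j) / X\<close> for \<open>1 \<le> j \<le> n\<close>,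
  followed by the 2-cycle formed by \<open>(1 + X (1 + X \<gamma>)) / X\<close> and \<open>(1 + X (X \<eta> - 1)) / X\<close>.\<close>

lemma branch_system:
  obtains \<gamma> \<eta> :: "complex fps" and \<delta> :: "nat \<Rightarrow> complex fps" where
    "\<gamma> \<in> rat_fps" "\<eta> \<in> rat_fps" "\<And>j. \<delta> j \<in> rat_fps"
    "6 * \<gamma> = fps_X * \<eta> - 1 - fps_X * \<delta> 1 - 3 * fps_X * \<gamma> ^ 2 - (1 + fps_X * \<gamma>) ^ 3"
    "6 * \<eta> = - (1 + fps_X * \<gamma> - fps_X * \<delta> 1 - 3 * fps_X * \<eta> ^ 2 - (fps_X * \<eta> - 1) ^ 3)"
    "\<And>j. 0 < j \<Longrightarrow> j < n \<Longrightarrow>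
       9 * \<delta> j = fps_X ^ 2 * (\<delta> (Suc j) - \<delta> 1 + 6 * \<delta> j ^ 2 - fps_X ^ 2 * \<delta> j ^ 3)"
    "n > 0 \<Longrightarrow> 9 * \<delta> n = 3 + fps_X * (1 + fps_X * \<gamma>) - fps_X ^ 2 * \<delta> 1 + 6 * fps_X ^ 2 * \<delta> n ^ 2
       - fps_X ^ 4 * \<delta> n ^ 3"
proof -
  \<comment> \<open>The unknowns are ordered as \<open>\<gamma>\<close>, \<open>\<delta> 1\<close>, ..., \<open>\<delta> n\<close>, \<open>\<eta>\<close>.\<close>
  define T :: "(nat \<Rightarrow> complex fps) \<Rightarrow> nat \<Rightarrow> complex fps" where
    "T = (\<lambda>X j. let \<gamma> = X 0; \<eta> = X (Suc n); d = X j; d' = X (Suc j); d1 = X 1 in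
       if j = 0 then fps_const (1/6) * (- 2 + fps_X *
          (\<eta> - d1 - 3 * \<gamma> ^ 2 - 3 * \<gamma> - 3 * fps_X * \<gamma> ^ 2 - fps_X ^ 2 * \<gamma> ^ 3))
       else if j < n then fps_const (1/9) * (0 + fps_X * (fps_X * (d' - d1 + 6 * d ^ 2 - fps_X ^ 2 * d ^ 3)))
       else if j = n then fps_const (1/9) * (3 + fps_X * (1 + fps_X * \<gamma> - fps_X * d1 + 6 * fps_X * d ^ 2 - fps_X ^ 3 * d ^ 3))
       else fps_const (1/6) * (- 2 + fps_X *
          (d1 - \<gamma> + 3 * \<eta> ^ 2 + fps_X ^ 2 * \<eta> ^ 3 - 3 * fps_X * \<eta> ^ 2 + 3 * \<eta>)))"
  obtain X where X: "T X = X" "\<And>i. X i \<in> rat_fps"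
  proof (rule fps_contraction_fixpoint[of T])
    fix X Y :: "nat \<Rightarrow> complex fps" and m j
    assume XY: "\<And>i. agree m (X i) (Y i)"
    \<comment> \<open>The cubes of the system are expanded in \<open>T\<close>, so that every
      unknown stands behind a factor \<open>fps_X\<close>.\<close>
    show "agree (Suc m) (T X j) (T Y j)"
      unfolding T_def Let_def
      by (intro agree_if; rule agree_affine; intro agree_intros XY)
  next
    fix X :: "nat \<Rightarrow> complex fps" and j
    assume X: "\<And>i. X i \<in> rat_fps"
    have "(0 :: complex fps) \<in> rat_fps" by (simp add: rat_fps_def)
    then show "T X j \<in> rat_fps"
      unfolding T_def Let_def by (auto intro!: rat_fps_intros X)
  qed blast
  have eq: "T X j = X j" for j using X(1) by simp
  have scale: "fps_const (c * d) * f = fps_const c * (fps_const d * f)" for c d and f :: "complex fps"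
    by (simp flip: fps_const_mult add: mult.assoc)
  \<comment> \<open>The constants are derivatives, as in Hensel lifting: 9 is that of (y - 1)^2 (y +
    2) at y = -2, and 6 is, up to sign, that of 3 c^2 at c = 1 and c = -1. They are invertible in Q,
    so the solution is rational.\<close>
  have c6: "6 * (fps_const (1/6) * f) = f" "9 * (fps_const (1/9) * f) = f" for f :: "complex fps"
    using scale[of 6 "1/6" f] scale[of 9 "1/9" f] by (simp_all add: numeral_fps_const)
  have g: "6 * X 0 = - 2 + fps_X * (X (Suc n) - X 1 - 3 * X 0 ^ 2 - 3 * X 0 - 3 * fps_X * X 0 ^ 2 - fps_X ^ 2 * X 0 ^ 3)"
    by (subst (1) eq[of 0, symmetric]) (simp only: T_def Let_def c6 if_True refl)
  have h: "6 * X (Suc n) = - 2 + fps_X *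
          (X 1 - X 0 + 3 * X (Suc n) ^ 2 + fps_X ^ 2 * X (Suc n) ^ 3 - 3 * fps_X * X (Suc n) ^ 2 + 3 * X (Suc n))"
    by (subst (1) eq[of "Suc n", symmetric]) (simp add: T_def Let_def c6)
  have d: "9 * X j = fps_X * (fps_X * (X (Suc j) - X 1 + 6 * X j ^ 2 - fps_X ^ 2 * X j ^ 3))" if "0 < j" "j < n" for j
    using that by (subst (1) eq[of j, symmetric]) (simp add: T_def Let_def c6)
  have e: "9 * X n = 3 + fps_X * (1 + fps_X * X 0 - fps_X * X 1 + 6 * fps_X * X n ^ 2 - fps_X ^ 3 * X n ^ 3)" if "n > 0"
    using that by (subst (1) eq[of n, symmetric]) (simp add: T_def Let_def c6)
  show ?thesis
  proof (rule that[of "X 0" "X (Suc n)" X])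
    show "6 * X 0 = fps_X * X (Suc n) - 1 - fps_X * X 1 - 3 * fps_X * X 0 ^ 2 - (1 + fps_X * X 0) ^ 3"
      using g by algebra
    show "6 * X (Suc n) = - (1 + fps_X * X 0 - fps_X * X 1 - 3 * fps_X * X (Suc n) ^ 2 - (fps_X * X (Suc n) - 1) ^ 3)"
      using h by algebra
    show "9 * X j = fps_X ^ 2 * (X (Suc j) - X 1 + 6 * X j ^ 2 - fps_X ^ 2 * X j ^ 3)" if "0 < j" "j < n" for j
      using d[OF that] by algebra
    show "9 * X n = 3 + fps_X * (1 + fps_X * X 0) - fps_X ^ 2 * X 1 + 6 * fps_X ^ 2 * X n ^ 2 - fps_X ^ 4 * X n ^ 3" if "n > 0"
      using e[OF that] by algebra
  qed (rule X)+
qed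

text \<open>For x_j = y_j / X the recursion is X^2 y_(j+1) = (y_j - 1)^2 (y_j + 2) + X^2 y_1. Near y
  = 1 + X c with y_1 = -2 + O(X^2), a successor with constant term 1 requires 3 c^2 = 3 to leading
  order; opposite signs of c give a 2-cycle instead of a fixed point.\<close>

lemma preper2_branch:
  assumes n: "n > 0"
  obtains w where "w \<in> rat_fps"
    "let x = crit_orbit fls_X_inv (fps_to_fls w * fls_X_inv) in
       x (Suc (Suc (Suc n))) = x (Suc n) \<and> x (Suc (Suc n)) \<noteq> x (Suc n) \<and> x n \<noteq> x (Suc (Suc n)) \<and>
       (n \<ge> 2 \<longrightarrow> x 2 \<noteq> fls_X_inv)"
proof -
  obtain \<gamma> \<eta> :: "complex fps" and \<delta> :: "nat \<Rightarrow> complex fps" where rat: "\<And>j. \<delta> j \<in> rat_fps"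
    and g: "6 * \<gamma> = fps_X * \<eta> - 1 - fps_X * \<delta> 1 - 3 * fps_X * \<gamma> ^ 2 - (1 + fps_X * \<gamma>) ^ 3"
    and h: "6 * \<eta> = - (1 + fps_X * \<gamma> - fps_X * \<delta> 1 - 3 * fps_X * \<eta> ^ 2 - (fps_X * \<eta> - 1) ^ 3)"
    and d: "\<And>j. 0 < j \<Longrightarrow> j < n \<Longrightarrow>
       9 * \<delta> j = fps_X ^ 2 * (\<delta> (Suc j) - \<delta> 1 + 6 * \<delta> j ^ 2 - fps_X ^ 2 * \<delta> j ^ 3)"
    and e: "9 * \<delta> n = 3 + fps_X * (1 + fps_X * \<gamma>) - fps_X ^ 2 * \<delta> 1 + 6 * fps_X ^ 2 * \<delta> n ^ 2
       - fps_X ^ 4 * \<delta> n ^ 3"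
    using branch_system[of n] n by metis
  \<comment> \<open>The last alternative serves both n + 1 and n + 3, which closes the
    cycle.\<close>
  define y where "y = (\<lambda>j. if j = 0 then 1 else if j \<le> n then - 2 + fps_X ^ 2 * \<delta> j
     else if j = Suc (Suc n) then 1 + fps_X * (fps_X * \<eta> - 1) else 1 + fps_X * (1 + fps_X * \<gamma>))"
  have y1: "y 1 = - 2 + fps_X ^ 2 * \<delta> 1" using n by (simp add: y_def)
  \<comment> \<open>This is y_1 - 1, so that \<open>w\<close> / X = x_1 - a = u.\<close>
  define w where "w = - 3 + fps_X ^ 2 * \<delta> 1"
  have w: "w \<in> rat_fps" unfolding w_def by (intro rat_fps_intros rat)
  have step: "fps_X ^ 2 * y (Suc j) = (y j - 1) ^ 2 * (y j + 2) + fps_X ^ 2 * y 1" if "j \<le> Suc (Suc n)" for j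
  proof -
    have "j = 0 \<or> (0 < j \<and> j < n) \<or> j = n \<or> j = Suc n \<or> j = Suc (Suc n)"
      using that by linarith
    then consider "j = 0" | "0 < j" "j < n" | "j = n" | "j = Suc n" | "j = Suc (Suc n)" by blast
    then show ?thesis
    proof cases
      case 1
      then show ?thesis by (simp add: y_def)
    next
      case 2
      then have "y j = - 2 + fps_X ^ 2 * \<delta> j" "y (Suc j) = - 2 + fps_X ^ 2 * \<delta> (Suc j)"
        by (simp_all add: y_def)
      with d[OF 2] y1 show ?thesis by algebra
    next
      case 3
      then have "y j = - 2 + fps_X ^ 2 * \<delta> n" "y (Suc j) = 1 + fps_X * (1 + fps_X * \<gamma>)"
        using n by (simp_all add: y_def)
      with e y1 show ?thesis by algebra
    next
      case 4
      then have "y j = 1 + fps_X * (1 + fps_X * \<gamma>)" "y (Suc j) = 1 + fps_X * (fps_X * \<eta> - 1)"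
        by (simp_all add: y_def)
      with g y1 show ?thesis by algebra
    next
      case 5
      then have "y j = 1 + fps_X * (fps_X * \<eta> - 1)" "y (Suc j) = 1 + fps_X * (1 + fps_X * \<gamma>)"
        by (simp_all add: y_def)
      with h y1 show ?thesis by algebra
    qed
  qed
  define x where "x = crit_orbit (fls_X_inv :: complex fls) (fps_to_fls w * fls_X_inv)"
  have inv: "fls_X_inv * fls_X = (1 :: complex fls)" by (simp add: fls_X_inv_times_conv_shift fls_X_conv_shift_1)
  have x: "x j = fps_to_fls (y j) * fls_X_inv" if "j \<le> Suc (Suc (Suc n))" for j
    using that
  proof (induction j)
    case 0
    show ?case by (simp add: x_def y_def)
  next
    case (Suc j)
    then have IH: "x j = fps_to_fls (y j) * fls_X_inv" and j: "j \<le> Suc (Suc n)" by simp_all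
    have "fps_to_fls (fps_X ^ 2 * y (Suc j)) = fps_to_fls ((y j - 1) ^ 2 * (y j + 2) + fps_X ^ 2 * y 1)"
      using step[OF j] by simp
    then have s: "fls_X ^ 2 * fps_to_fls (y (Suc j))
        = (fps_to_fls (y j) - 1) ^ 2 * (fps_to_fls (y j) + 2) + fls_X ^ 2 * fps_to_fls (y 1)"
      by (simp add: fls_times_fps_to_fls fps_to_fls_power)
    have "w = y 1 - 1" unfolding w_def y1 by simp
    then have w': "fps_to_fls w = fps_to_fls (y 1) - 1" by simp
    have "x (Suc j) = (x j - fls_X_inv) ^ 2 * (x j + 2 * fls_X_inv) + fls_X_inv + fps_to_fls w * fls_X_inv"
      unfolding x_def by (rule crit_orbit_Suc_alt)
    also have "\<dots> = fps_to_fls (y (Suc j)) * fls_X_inv"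
      unfolding IH w' using s inv by algebra
    finally show ?case .
  qed
  have cong: "y i = y j" if "x i = x j" "i \<le> Suc (Suc (Suc n))" "j \<le> Suc (Suc (Suc n))" for i j
    using that x by simp
  have y0: "y j $ 0 = - 2" if "0 < j" "j \<le> n" for j
    using that by (simp add: y_def power2_eq_square mult.assoc)
  show ?thesis
  proof (rule that[OF w], unfold Let_def x_def[symmetric], intro conjI impI)
    show "x (Suc (Suc (Suc n))) = x (Suc n)" by (simp add: x y_def)
    show "x (Suc (Suc n)) \<noteq> x (Suc n)"
    proof
      assume "x (Suc (Suc n)) = x (Suc n)"
      \<comment> \<open>The coefficients of X are -1 and 1; the constant terms agree.\<close>
      from cong[OF this] have "y (Suc (Suc n)) $ 1 = y (Suc n) $ 1" by simp
      then show False by (simp add: y_def)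
    qed
    show "x n \<noteq> x (Suc (Suc n))"
    proof
      assume "x n = x (Suc (Suc n))"
      from cong[OF this] have "y n $ 0 = y (Suc (Suc n)) $ 0" by simp
      then show False using y0[of n] n by (simp add: y_def)
    qed
    show "x 2 \<noteq> fls_X_inv" if "n \<ge> 2"
    proof
      assume "x 2 = fls_X_inv"
      then have "x 2 = x 0" by (simp add: x_def)
      from cong[OF this] have "y 2 $ 0 = y 0 $ 0" using that by simp
      then show False using y0[of 2] that by (simp add: y_def)
    qed
  qed
qed

text \<open>For large a, E has a root u close to -1/(3a). With u = X v the equation reads -3 v = 1 +
  X^2 v^2.\<close>

lemma period2_branch:
  obtains w where "w \<in> rat_fps" "period2_poly fls_X_inv (fps_to_fls w * fls_X_inv) = 0"
proof -
  define T :: "(unit \<Rightarrow> complex fps) \<Rightarrow> unit \<Rightarrow> complex fps" where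
    "T = (\<lambda>X _. fps_const (- 1/3) * (1 + fps_X * (fps_X * X () ^ 2)))"
  obtain X where X: "T X = X" "\<And>i. X i \<in> rat_fps"
  proof (rule fps_contraction_fixpoint[of T])
    fix X Y :: "unit \<Rightarrow> complex fps" and m j
    assume XY: "\<And>i. agree m (X i) (Y i)"
    show "agree (Suc m) (T X j) (T Y j)"
      unfolding T_def by (rule agree_affine) (intro agree_intros XY)
  next
    fix X :: "unit \<Rightarrow> complex fps" and j
    assume X: "\<And>i. X i \<in> rat_fps"
    then show "T X j \<in> rat_fps"
      unfolding T_def by (auto intro!: rat_fps_intros X)
  qed blast
  define v where "v = X ()"
  have "fps_const (- 1/3) * (1 + fps_X * (fps_X * v ^ 2)) = v"
    using fun_cong[OF X(1), of "()"] by (simp add: T_def v_def)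
  then have "fps_const (- 3) * v = fps_const (- 3) * (fps_const (- 1/3) * (1 + fps_X * (fps_X * v ^ 2)))"
    by simp
  also have "\<dots> = fps_const (- 3 * (- 1/3)) * (1 + fps_X * (fps_X * v ^ 2))"
    by (simp only: fps_const_mult[symmetric] mult.assoc)
  finally have v: "- 3 * v = 1 + fps_X * (fps_X * v ^ 2)"
    by (simp add: numeral_fps_const flip: fps_const_neg)
  define V where "V = fps_to_fls v"
  have "fps_to_fls (- 3 * v) = fps_to_fls (1 + fps_X * (fps_X * v ^ 2))" using v by simp
  then have V: "- 3 * V = 1 + fls_X * (fls_X * V ^ 2)"
    by (simp add: V_def fls_times_fps_to_fls fps_to_fls_power)
  have inv: "fls_X_inv * fls_X = (1 :: complex fls)" by (simp add: fls_X_inv_times_conv_shift fls_X_conv_shift_1)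
  show ?thesis
  proof (rule that[of "fps_X ^ 2 * v"])
    show "fps_X ^ 2 * v \<in> rat_fps" unfolding v_def by (intro rat_fps_intros X)
    have e: "fps_to_fls (fps_X ^ 2 * v) = fls_X ^ 2 * V"
      by (simp add: V_def fls_times_fps_to_fls fps_to_fls_power)
    show "period2_poly fls_X_inv (fps_to_fls (fps_X ^ 2 * v) * fls_X_inv) = 0"
      unfolding e period2_poly_def using V inv by algebra
  qed
qed

end

section \<open>Curves in the moduli space\<close>

abbreviation evalc :: "complex \<Rightarrow> complex \<Rightarrow> complex poly poly \<Rightarrow> complex" where
  "evalc \<equiv> eval2 (\<lambda>x. x)"

lemma is_hom_evalc: "is_hom (evalc a u)"
  by (intro is_hom_eval2 is_hom_id)

lemmas evalc_simps = is_hom_simps[OF is_hom_evalc] eval2_vars[OF is_hom_id]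

lemma evalc_pCons: "evalc a u (pCons c p) = poly c a + u * evalc a u p"
  by (simp add: eval2_def eval_hom_pCons is_hom_eval_hom is_hom_id) (simp add: eval_hom_def map_poly_idI)

lemma evalc_0: "evalc a u 0 = 0"
  by (simp add: is_hom_0 is_hom_evalc)

lemma evalc_poly: "evalc a u p = poly (map_poly (\<lambda>c. poly c a) p) u"
  by (induction p) (simp_all add: evalc_pCons evalc_0 map_poly_pCons)

lemma moduli_pt_nth [simp]:
  "moduli_pt a b $ 1 = a ^ 2" "moduli_pt a b $ 2 = a * b" "moduli_pt a b $ 3 = b ^ 2"
  by (simp_all add: moduli_pt_def)

lemma moduli_pt_minus: "moduli_pt (- a) (- b) = moduli_pt a b"
  by (simp add: moduli_pt_def)

lemma polyfun_pullback:
  assumes "q \<in> polyfuns"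
  obtains p where "\<And>a u. q (moduli_pt a (a + u)) = evalc a u p"
proof -
  have "\<exists>p. \<forall>a u. q (moduli_pt a (a + u)) = evalc a u p"
    using assms
  proof induction
    case (const c)
    show ?case by (intro exI[of _ "[:[:c:]:]"]) (simp add: evalc_pCons evalc_0)
  next
    case (coord i)
    consider "i = 1" | "i = 2" | "i = 3" using exhaust_3[of i] by blast
    then show ?case
    proof cases
      case 1
      then show ?thesis by (intro exI[of _ "a_var ^ 2"]) (simp add: evalc_simps)
    next
      case 2
      then show ?thesis by (intro exI[of _ "a_var * (a_var + u_var)"]) (simp only: evalc_simps moduli_pt_nth simp_thms)
    next
      case 3
      then show ?thesis by (intro exI[of _ "(a_var + u_var) ^ 2"]) (simp only: evalc_simps moduli_pt_nth simp_thms)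
    qed
  next
    case (add p q)
    then obtain p' q' where "\<forall>a u. p (moduli_pt a (a + u)) = evalc a u p'"
      "\<forall>a u. q (moduli_pt a (a + u)) = evalc a u q'" by blast
    then show ?case by (intro exI[of _ "p' + q'"]) (simp add: evalc_simps)
  next
    case (mult p q)
    then obtain p' q' where "\<forall>a u. p (moduli_pt a (a + u)) = evalc a u p'"
      "\<forall>a u. q (moduli_pt a (a + u)) = evalc a u q'" by blast
    then show ?case by (intro exI[of _ "p' * q'"]) (simp add: evalc_simps)
  qed
  with that show ?thesis by blast
qed

lemma polyfuns_diff: "p \<in> polyfuns \<Longrightarrow> q \<in> polyfuns \<Longrightarrow> (\<lambda>x. p x - q x) \<in> polyfuns"
  using polyfuns.add[OF _ polyfuns.mult[OF polyfuns.const[of "- 1"]], of p q] by simp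

text \<open>Over the invariants of (a, u) -> (-a, -u), all polynomials are generated by 1, a and u.
  Multiplication by a or u stays in this span, as a^2, a u and u^2 are linear in the coordinates of
  the moduli space.\<close>

lemma poly_odd_even_parts:
  obtains q0 q1 q2 :: "complex^3 \<Rightarrow> complex" where
    "q0 \<in> polyfuns" "q1 \<in> polyfuns" "q2 \<in> polyfuns"
    "\<And>a u. evalc a u p = q0 (moduli_pt a (a + u)) + a * q1 (moduli_pt a (a + u)) + u * q2 (moduli_pt a (a + u))"
proof -
  define good where "good = (\<lambda>f :: complex \<Rightarrow> complex \<Rightarrow> complex. \<exists>q0\<in>polyfuns. \<exists>q1\<in>polyfuns. \<exists>q2\<in>polyfuns.
    \<forall>a u. f a u = q0 (moduli_pt a (a + u)) + a * q1 (moduli_pt a (a + u)) + u * q2 (moduli_pt a (a + u)))"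
  note closure = polyfuns.const polyfuns.coord polyfuns.add polyfuns.mult polyfuns_diff
  have add: "good (\<lambda>a u. f a u + g a u)" if "good f" "good g" for f g
  proof -
    obtain q0 q1 q2 where q: "q0 \<in> polyfuns" "q1 \<in> polyfuns" "q2 \<in> polyfuns"
      "\<forall>a u. f a u = q0 (moduli_pt a (a + u)) + a * q1 (moduli_pt a (a + u)) + u * q2 (moduli_pt a (a + u))"
      using \<open>good f\<close> unfolding good_def by blast
    obtain r0 r1 r2 where r: "r0 \<in> polyfuns" "r1 \<in> polyfuns" "r2 \<in> polyfuns"
      "\<forall>a u. g a u = r0 (moduli_pt a (a + u)) + a * r1 (moduli_pt a (a + u)) + u * r2 (moduli_pt a (a + u))"
      using \<open>good g\<close> unfolding good_def by blast
    show ?thesis unfolding good_def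
      by (rule bexI[of _ "\<lambda>x. q0 x + r0 x"], rule bexI[of _ "\<lambda>x. q1 x + r1 x"], rule bexI[of _ "\<lambda>x. q2 x + r2 x"])
        (use q r in \<open>simp_all add: closure algebra_simps\<close>)
  qed
  have a_mult: "good (\<lambda>a u. a * f a u)" if "good f" for f
  proof -
    obtain q0 q1 q2 where q: "q0 \<in> polyfuns" "q1 \<in> polyfuns" "q2 \<in> polyfuns"
      "\<forall>a u. f a u = q0 (moduli_pt a (a + u)) + a * q1 (moduli_pt a (a + u)) + u * q2 (moduli_pt a (a + u))"
      using \<open>good f\<close> unfolding good_def by blast
    show ?thesis unfolding good_def
      by (rule bexI[of _ "\<lambda>x. x $ 1 * q1 x + (x $ 2 - x $ 1) * q2 x"], rule bexI[of _ q0], rule bexI[of _ "\<lambda>_. 0"])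
        (use q in \<open>simp_all add: closure algebra_simps power2_eq_square\<close>)
  qed
  have u_mult: "good (\<lambda>a u. u * f a u)" if "good f" for f
  proof -
    obtain q0 q1 q2 where q: "q0 \<in> polyfuns" "q1 \<in> polyfuns" "q2 \<in> polyfuns"
      "\<forall>a u. f a u = q0 (moduli_pt a (a + u)) + a * q1 (moduli_pt a (a + u)) + u * q2 (moduli_pt a (a + u))"
      using \<open>good f\<close> unfolding good_def by blast
    show ?thesis unfolding good_def
      by (rule bexI[of _ "\<lambda>x. (x $ 2 - x $ 1) * q1 x + (x $ 3 - 2 * x $ 2 + x $ 1) * q2 x"], rule bexI[of _ "\<lambda>_. 0"], rule bexI[of _ q0])
        (use q in \<open>simp_all add: closure algebra_simps power2_eq_square\<close>)
  qed
  have const: "good (\<lambda>a u. c)" for c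
    unfolding good_def
    by (rule bexI[of _ "\<lambda>_. c"], rule bexI[of _ "\<lambda>_. 0"], rule bexI[of _ "\<lambda>_. 0"]) (simp_all add: closure)
  have inner: "good (\<lambda>a u. poly c a)" for c
    by (induction c) (simp_all add: const add a_mult)
  have "good (\<lambda>a u. evalc a u p)"
    by (induction p) (simp_all add: evalc_0 evalc_pCons const add u_mult inner)
  then show ?thesis unfolding good_def using that by blast
qed

text \<open>The product is (q0 + o)(q0 - o) with odd part o = a q1 + u q2, and the square of o is an
  invariant.\<close>

lemma norm_descends:
  obtains q :: "complex^3 \<Rightarrow> complex" where "q \<in> polyfuns"
    "\<And>a u. q (moduli_pt a (a + u)) = evalc a u p * evalc (- a) (- u) p"
proof -
  obtain q0 q1 q2 :: "complex^3 \<Rightarrow> complex" where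
    q: "q0 \<in> polyfuns" "q1 \<in> polyfuns" "q2 \<in> polyfuns" and
    eq: "\<And>a u. evalc a u p = q0 (moduli_pt a (a + u)) + a * q1 (moduli_pt a (a + u)) + u * q2 (moduli_pt a (a + u))"
    by (rule poly_odd_even_parts[of p]) blast
  note closure = polyfuns.const polyfuns.coord polyfuns.add polyfuns.mult polyfuns_diff
  let ?q = "\<lambda>x. q0 x * q0 x - (x $ 1 * (q1 x * q1 x) + 2 * (x $ 2 - x $ 1) * (q1 x * q2 x)
      + (x $ 3 - 2 * x $ 2 + x $ 1) * (q2 x * q2 x))"
  show ?thesis
  proof (rule that[of ?q])
    show "?q \<in> polyfuns" by (intro closure q)
    fix a u
    have minus: "evalc (- a) (- u) p = q0 (moduli_pt a (a + u)) - a * q1 (moduli_pt a (a + u)) - u * q2 (moduli_pt a (a + u))"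
      using eq[of "- a" "- u"] moduli_pt_minus[of a "a + u"] by simp
    show "?q (moduli_pt a (a + u)) = evalc a u p * evalc (- a) (- u) p"
      unfolding eq[of a u] minus moduli_pt_nth by algebra
  qed
qed

section \<open>Closed subsets of the moduli space\<close>

lemma topspace_M3: "topspace M3 = {moduli_pt a b | a b. True}"
  by (simp add: M3_def)

lemma closedin_M3_iff: "closedin M3 Z \<longleftrightarrow> (\<exists>P\<subseteq>polyfuns. Z = zero_locus P \<inter> topspace M3)"
  unfolding topspace_M3 unfolding M3_def closedin_subtopology closedin_zariski by auto

lemma closedin_M3_zeros: "q \<in> polyfuns \<Longrightarrow> closedin M3 {x \<in> topspace M3. q x = 0}"
  unfolding closedin_M3_iff by (intro exI[of _ "{q}"]) (auto simp: zero_locus_def)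

lemma closedin_M3_separate:
  assumes "closedin M3 Z" "x \<in> topspace M3" "x \<notin> Z"
  obtains q where "q \<in> polyfuns" "q x \<noteq> 0" "\<And>z. z \<in> Z \<Longrightarrow> q z = 0"
  using assms unfolding closedin_M3_iff zero_locus_def by blast

lemma closedin_M3_singleton:
  assumes "x \<in> topspace M3"
  shows "closedin M3 {x}"
  unfolding closedin_M3_iff
proof (intro exI conjI)
  let ?P = "range (\<lambda>i y. y $ i - x $ i)"
  show "?P \<subseteq> polyfuns" by (auto intro!: polyfuns_diff polyfuns.coord polyfuns.const)
  show "{x} = zero_locus ?P \<inter> topspace M3"
    using assms by (auto simp: zero_locus_def vec_eq_iff)
qed

lemma closedin_M3_finite:
  assumes "finite Z" "Z \<subseteq> topspace M3"
  shows "closedin M3 Z"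
  using assms by (induction Z) (auto intro: closedin_Un[of M3 "{_}", simplified] closedin_M3_singleton)

text \<open>Points are closed, so a finite subspace is discrete.\<close>

lemma finite_irreducible_in_M3:
  assumes "finite Z" "irreducible_in M3 Z"
  obtains z where "Z = {z}"
proof -
  have Z: "Z \<subseteq> topspace M3" "irreducible_space (subtopology M3 Z)"
    using assms(2) by (auto simp: irreducible_in_def)
  then have top: "topspace (subtopology M3 Z) = Z" by auto
  have closed: "closedin (subtopology M3 Z) Y" if "Y \<subseteq> Z" for Y
    using that Z closedin_M3_finite[of Y] finite_subset[OF that assms(1)]
    by (meson closedin_subset_topspace order.trans)
  obtain z where z: "z \<in> Z" using Z(2) top unfolding irreducible_space_def by blast
  have "{z} = Z \<or> Z - {z} = Z"
    using Z(2) closed[of "{z}"] closed[of "Z - {z}"] z unfolding irreducible_space_def top by blast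
  with z that show ?thesis by blast
qed

text \<open>\<open>T\<close> only has to lie between the points with F = 0, D \<noteq> 0 and those
  with F = 0. A proper closed subset of the closure is killed by a function whose pullback is not
  divisible by the prime \<open>F\<close>. The product of two such pullbacks is again not divisible,
  which gives irreducibility; eliminating u between one of them and \<open>F\<close> leaves finitely
  many points, which bounds the dimension.\<close>

lemma plane_curve_image_irreducible:
  fixes F D :: "complex poly poly" and T :: "(complex \<times> complex) set"
  assumes F: "prime_elem F" "degree F > 0" "lead_coeff F = 1"
    and D: "\<not> F dvd D"
    and T_zero: "\<And>a u. (a, u) \<in> T \<Longrightarrow> evalc a u F = 0"
    and zero_T: "\<And>a u. evalc a u F = 0 \<Longrightarrow> evalc a u D \<noteq> 0 \<Longrightarrow> (a, u) \<in> T"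
  shows "irreducible_curve M3 (M3 closure_of ((\<lambda>(a, u). moduli_pt a (a + u)) ` T))"
proof -
  define S where "S = (\<lambda>(a, u). moduli_pt a (a + u)) ` T"
  define C where "C = M3 closure_of S"
  have elim: "\<exists>r. r \<noteq> 0 \<and> (\<forall>a u. evalc a u F = 0 \<and> evalc a u p = 0 \<longrightarrow> poly r a = 0)" if p: "\<not> F dvd p" for p
  proof -
    obtain \<alpha> \<gamma> r where r: "\<alpha> * F + \<gamma> * p = [:r:]" "r \<noteq> 0" by (rule prime_elem_bezout[OF F(1,2) p])
    have "poly r a = 0" if "evalc a u F = 0" "evalc a u p = 0" for a u
    proof -
      have "evalc a u [:r:] = 0" unfolding r(1)[symmetric] using that by (simp add: evalc_simps)
      then show ?thesis by (simp add: evalc_pCons evalc_0)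
    qed
    with r(2) show ?thesis by blast
  qed
  \<comment> \<open>Being monic in u, \<open>F\<close> keeps its degree when a is specialised, so
    all fibres over a are nonempty and finite.\<close>
  have lc_eval: "degree (map_poly (\<lambda>c. poly c a) F) = degree F" for a
  proof (rule antisym[OF map_poly_degree_leq])
    have "coeff (map_poly (\<lambda>c. poly c a) F) (degree F) = 1" using F(3) by (simp add: coeff_map_poly)
    then show "degree F \<le> degree (map_poly (\<lambda>c. poly c a) F)" by (intro le_degree) simp
  qed
  have generic: "\<exists>a u. (a, u) \<in> T \<and> poly s a \<noteq> 0 \<and> evalc a u p \<noteq> 0" if "s \<noteq> 0" "\<not> F dvd p" for s p
  proof -
    have "\<not> F dvd p * D" using that(2) D F(1) prime_elem_dvd_multD by blast
    from elim[OF this] obtain r where r: "r \<noteq> 0"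
      "\<And>a u. evalc a u F = 0 \<Longrightarrow> evalc a u (p * D) = 0 \<Longrightarrow> poly r a = 0" by blast
    have "s * r \<noteq> 0" using that(1) r(1) by simp
    then obtain a where a: "poly (s * r) a \<noteq> 0" using poly_all_0_iff_0 by blast
    have "\<not> constant (poly (map_poly (\<lambda>c. poly c a) F))" using lc_eval F(2) by (simp add: constant_degree)
    then obtain u where u: "evalc a u F = 0" unfolding evalc_poly using fundamental_theorem_of_algebra by blast
    with r(2)[of a u] a have "evalc a u p \<noteq> 0" "evalc a u D \<noteq> 0" by (auto simp: evalc_simps)
    with zero_T u a show ?thesis by auto
  qed
  have S_top: "S \<subseteq> topspace M3" unfolding S_def topspace_M3 by auto
  have SC: "S \<subseteq> C" unfolding C_def by (rule closure_of_subset[OF S_top])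
  have C_closed: "closedin M3 C" unfolding C_def by simp
  have C_top: "C \<subseteq> topspace M3" using C_closed by (rule closedin_subset)
  have C_min: "C \<subseteq> A" if "closedin M3 A" "S \<subseteq> A" for A
    unfolding C_def using that by (intro closure_of_minimal)
  have not_one: "\<not> F dvd 1" using F(1) by (simp add: prime_elem_not_unit)
  obtain a0 u0 where s0: "(a0, u0) \<in> T" using generic[of 1 1] not_one by auto
  define s0 where "s0 = moduli_pt a0 (a0 + u0)"
  have s0_S: "s0 \<in> S" unfolding S_def s0_def using s0 by force
  have not_dvd: "\<not> F dvd p" if "(a, u) \<in> T" "evalc a u p \<noteq> 0" for a u p
  proof
    assume "F dvd p"
    then obtain q where "p = F * q" by blast
    with that T_zero show False by (simp add: evalc_simps)
  qed
  have separate: "\<exists>q p. q \<in> polyfuns \<and> (\<forall>z\<in>A. q z = 0) \<and> \<not> F dvd p \<and> (\<forall>a u. q (moduli_pt a (a + u)) = evalc a u p)"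
    if A: "closedin M3 A" "A \<subseteq> C" "A \<noteq> C" for A
  proof -
    have "\<not> S \<subseteq> A" using C_min A by blast
    then obtain a u where au: "(a, u) \<in> T" "moduli_pt a (a + u) \<notin> A" unfolding S_def by auto
    then have "moduli_pt a (a + u) \<in> topspace M3" unfolding topspace_M3 by blast
    with au(2) obtain q where q: "q \<in> polyfuns" "q (moduli_pt a (a + u)) \<noteq> 0" "\<And>z. z \<in> A \<Longrightarrow> q z = 0"
      using closedin_M3_separate[OF A(1), of "moduli_pt a (a + u)"] by blast
    obtain p where p: "\<And>a u. q (moduli_pt a (a + u)) = evalc a u p" by (rule polyfun_pullback[OF q(1)]) blast
    have "\<not> F dvd p" using not_dvd[OF au(1)] q(2) p by simp
    with q p show ?thesis by blast
  qed
  have C_irred: "irreducible_space (subtopology M3 C)"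
    unfolding irreducible_space_def
  proof (intro conjI allI impI)
    have top: "topspace (subtopology M3 C) = C" using C_top by auto
    show "topspace (subtopology M3 C) \<noteq> {}" using top s0_S SC by auto
    fix A B assume AB: "closedin (subtopology M3 C) A \<and> closedin (subtopology M3 C) B \<and> A \<union> B = topspace (subtopology M3 C)"
    show "A = topspace (subtopology M3 C) \<or> B = topspace (subtopology M3 C)"
    proof (rule ccontr)
      assume "\<not> ?thesis"
      then have ne: "A \<noteq> C" "B \<noteq> C" using top by auto
      have AB': "closedin M3 A" "A \<subseteq> C" "closedin M3 B" "B \<subseteq> C" "A \<union> B = C"
        using AB C_closed top by (auto simp: closedin_closed_subtopology)
      obtain q1 p1 where 1: "\<forall>z\<in>A. q1 z = 0" "\<not> F dvd p1" "\<forall>a u. q1 (moduli_pt a (a + u)) = evalc a u p1"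
        using separate[of A] AB' ne by blast
      obtain q2 p2 where 2: "\<forall>z\<in>B. q2 z = 0" "\<not> F dvd p2" "\<forall>a u. q2 (moduli_pt a (a + u)) = evalc a u p2"
        using separate[of B] AB' ne by blast
      have "\<not> F dvd p1 * p2" using 1(2) 2(2) F(1) prime_elem_dvd_multD by blast
      with generic[of 1 "p1 * p2"] obtain a u where au: "(a, u) \<in> T" "evalc a u (p1 * p2) \<noteq> 0" by auto
      have "moduli_pt a (a + u) \<in> C" using au(1) SC unfolding S_def by auto
      with AB'(5) 1 2 have "evalc a u p1 = 0 \<or> evalc a u p2 = 0" by (metis UnE)
      with au(2) show False by (auto simp: evalc_simps)
    qed
  qed
  have small: "finite Z" if Z: "closedin M3 Z" "Z \<subseteq> C" "Z \<noteq> C" for Z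
  proof -
    obtain q p where q: "\<forall>z\<in>Z. q z = 0" "\<not> F dvd p" "\<forall>a u. q (moduli_pt a (a + u)) = evalc a u p"
      using separate[OF Z] by blast
    obtain r where r: "r \<noteq> 0" "\<And>a u. evalc a u F = 0 \<Longrightarrow> evalc a u p = 0 \<Longrightarrow> poly r a = 0"
      using elim[OF q(2)] by blast
    \<comment> \<open>Points of the closure need not come from \<open>T\<close>, so an invariant
      equation is required; where it vanishes, one of the two representatives satisfies F =
      0.\<close>
    obtain N where N: "N \<in> polyfuns" "\<And>a u. N (moduli_pt a (a + u)) = evalc a u F * evalc (- a) (- u) F"
      by (rule norm_descends[of F]) blast
    have "S \<subseteq> {x \<in> topspace M3. N x = 0}"
      using S_top T_zero unfolding S_def by (auto simp: N)
    then have CN: "C \<subseteq> {x \<in> topspace M3. N x = 0}" by (intro C_min closedin_M3_zeros N)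
    let ?V = "SIGMA a : {a. poly r a = 0}. {u. poly (map_poly (\<lambda>c. poly c a) F) u = 0}"
    have "Z \<subseteq> (\<lambda>(a, u). moduli_pt a (a + u)) ` ?V"
    proof
      fix z assume z: "z \<in> Z"
      then have zN: "z \<in> topspace M3" "N z = 0" using Z(2) CN by auto
      then obtain a b where ab: "z = moduli_pt a b" unfolding topspace_M3 by blast
      define u where "u = b - a"
      have zu: "z = moduli_pt a (a + u)" by (simp add: ab u_def)
      have zu': "z = moduli_pt (- a) (- a + - u)" using moduli_pt_minus[of a "a + u"] zu by simp
      from zN(2) have "evalc a u F = 0 \<or> evalc (- a) (- u) F = 0" unfolding zu N by simp
      then obtain a' u' where a': "z = moduli_pt a' (a' + u')" "evalc a' u' F = 0" using zu zu' by blast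
      have "evalc a' u' p = 0" using q z a'(1) by metis
      with r(2) a'(2) have "(a', u') \<in> ?V" by (simp add: evalc_poly)
      with a'(1) show "z \<in> (\<lambda>(a, u). moduli_pt a (a + u)) ` ?V" by force
    qed
    moreover have "finite ?V"
    proof (rule finite_SigmaI)
      show "finite {a. poly r a = 0}" using r(1) by (rule poly_roots_finite)
      fix a
      have "map_poly (\<lambda>c. poly c a) F \<noteq> 0" using lc_eval[of a] F(2) by auto
      then show "finite {u. poly (map_poly (\<lambda>c. poly c a) F) u = 0}" by (rule poly_roots_finite)
    qed
    ultimately show ?thesis using finite_surj by blast
  qed
  have sub: "subtopology (subtopology M3 C) Z = subtopology M3 Z" if "Z \<subseteq> C" for Z
    using that by (simp add: subtopology_subtopology Int_absorb1)
  have "krull_dim (subtopology M3 C) = 1"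
  proof (rule antisym)
    show "krull_dim (subtopology M3 C) \<le> 1"
      unfolding krull_dim_def
    proof (rule Sup_least)
      fix x assume "x \<in> {enat n | n. \<exists>Z :: nat \<Rightarrow> (complex^3) set.
        (\<forall>i\<le>n. closedin (subtopology M3 C) (Z i) \<and> irreducible_in (subtopology M3 C) (Z i)) \<and> (\<forall>i<n. Z i \<subset> Z (Suc i))}"
      then obtain n Z where n: "x = enat n"
        and Z: "\<And>i. i \<le> n \<Longrightarrow> closedin (subtopology M3 C) (Z i)" "\<And>i. i \<le> n \<Longrightarrow> irreducible_in (subtopology M3 C) (Z i)"
        and chain: "\<And>i. i < n \<Longrightarrow> Z i \<subset> Z (Suc i)" by blast
      have "n \<le> 1"
      proof (rule ccontr)
        assume "\<not> n \<le> 1"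
        then have n2: "n \<ge> 2" by simp
        have closed: "closedin M3 (Z i)" "Z i \<subseteq> C" if "i \<le> n" for i
          using Z(1)[OF that] C_closed by (auto simp: closedin_closed_subtopology)
        have c01: "Z 0 \<subset> Z 1" "Z 1 \<subset> Z 2" using chain[of 0] chain[of 1] n2 by (auto simp: numeral_2_eq_2)
        have "Z 1 \<noteq> C" using c01(2) closed(2)[of 2] n2 by auto
        then have "finite (Z 1)" using small closed[of 1] n2 by simp
        moreover have "irreducible_in M3 (Z 1)"
          using Z(2)[of 1] n2 sub[of "Z 1"] closed(2)[of 1] C_top unfolding irreducible_in_def by auto
        ultimately obtain z where "Z 1 = {z}" by (rule finite_irreducible_in_M3)
        with c01(1) have "Z 0 = {}" by auto
        then show False using Z(2)[of 0] n2 unfolding irreducible_in_def irreducible_space_def by simp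
      qed
      then show "x \<le> 1" using n by (simp add: one_enat_def)
    qed
    \<comment> \<open>A point with a^2 different from a0^2 differs from \<open>s0\<close> in its
      first coordinate, so the closure is not a single point.\<close>
    have "[:- (a0 ^ 2), 0, 1:] \<noteq> 0" by simp
    then obtain a u where au: "(a, u) \<in> T" "poly [:- (a0 ^ 2), 0, 1:] a \<noteq> 0"
      using generic[of _ 1] not_one by blast
    have "moduli_pt a (a + u) \<in> C" using au(1) SC unfolding S_def by auto
    moreover have "moduli_pt a (a + u) \<noteq> s0"
    proof
      assume "moduli_pt a (a + u) = s0"
      then have "moduli_pt a (a + u) $ 1 = s0 $ 1" by simp
      with au(2) show False by (simp add: s0_def power2_eq_square)
    qed
    ultimately have s0_C: "{s0} \<subset> C" using s0_S SC by auto
    define Z where "Z = (\<lambda>i :: nat. if i = 0 then {s0} else C)"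
    have "irreducible_space (subtopology M3 {s0})"
      using s0_C C_top unfolding irreducible_space_def by auto
    then have "closedin (subtopology M3 C) (Z i) \<and> irreducible_in (subtopology M3 C) (Z i)" for i
      using s0_C C_top C_closed C_irred sub[of "Z i"] closedin_M3_singleton[of s0] closedin_subset_topspace[of M3 "Z i" C]
      unfolding irreducible_in_def Z_def by auto
    moreover have "\<forall>i<1. Z i \<subset> Z (Suc i)" using s0_C by (simp add: Z_def)
    ultimately have "enat 1 \<in> {enat n | n. \<exists>Z :: nat \<Rightarrow> (complex^3) set.
        (\<forall>i\<le>n. closedin (subtopology M3 C) (Z i) \<and> irreducible_in (subtopology M3 C) (Z i)) \<and> (\<forall>i<n. Z i \<subset> Z (Suc i))}"
      by blast
    then show "1 \<le> krull_dim (subtopology M3 C)"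
      unfolding krull_dim_def one_enat_def by (rule Sup_upper)
  qed
  then show ?thesis
    using C_closed C_irred C_top unfolding irreducible_curve_def irreducible_in_def C_def S_def by blast
qed

section \<open>The loci of 2-preperiodic critical points\<close>

lemma cubic_funpow_crit_orbit: "(cubic a (a + u) ^^ n) a = crit_orbit a u n"
  by (induction n) (simp_all add: cubic_def algebra_simps)

lemma strictly_periodic_2_iff:
  "strictly_periodic 2 f x \<longleftrightarrow> f (f x) = x \<and> f x \<noteq> x"
proof -
  have "0 < m \<and> m < 2 \<longleftrightarrow> m = 1" for m :: nat by auto
  then show ?thesis by (simp add: strictly_periodic_def numeral_2_eq_2)
qed

text \<open>Periodicity of an earlier point passes to x_n, and the tail from x_(n+1) on has period
  dividing 2. So a periodic x_n equals x_(n+2), and one inequality excludes all earlier periodic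
  points.\<close>

lemma strictly_preperiodic_2_iff:
  fixes f :: "'a \<Rightarrow> 'a" and a :: 'a
  defines "x \<equiv> \<lambda>n. (f ^^ n) a"
  shows "strictly_preperiodic (Suc n) 2 f a \<longleftrightarrow>
    x (Suc (Suc (Suc n))) = x (Suc n) \<and> x (Suc (Suc n)) \<noteq> x (Suc n) \<and> x n \<noteq> x (Suc (Suc n))"
proof -
  have iter: "(f ^^ N) (x l) = x (N + l)" for N l by (simp add: x_def funpow_add)
  have "(\<forall>l<Suc n. \<not> periodic_point f (x l)) \<longleftrightarrow> x n \<noteq> x (Suc (Suc n))"
    if per: "x (Suc (Suc (Suc n))) = x (Suc n)"
  proof
    assume "\<forall>l<Suc n. \<not> periodic_point f (x l)"
    then have "\<not> periodic_point f (x n)" by blast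
    then have "(f ^^ 2) (x n) \<noteq> x n" unfolding periodic_point_def by (metis zero_less_numeral)
    then show "x n \<noteq> x (Suc (Suc n))" unfolding iter by (simp add: eq_commute)
  next
    assume ne: "x n \<noteq> x (Suc (Suc n))"
    show "\<forall>l<Suc n. \<not> periodic_point f (x l)"
    proof (intro allI impI notI)
      fix l assume l: "l < Suc n" and "periodic_point f (x l)"
      then obtain N where N: "N > 0" "x (N + l) = x l" unfolding periodic_point_def iter by blast
      have shift: "x (j + i) = x (j' + i)" if "x j = x j'" for i j j'
        using that by (induction i) (simp_all add: x_def)
      have once: "x (N + n) = x n" using shift[OF N(2), of "n - l"] l by simp
      \<comment> \<open>Doubling the period makes the shift even, so that the 2-periodic tail
        identifies the result with x_(n+2).\<close>
      have "2 * N + n = N + n + N" by simp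
      also have "x (N + n + N) = x (n + N)" using once by (rule shift)
      also have "n + N = N + n" by simp
      finally have "x (2 * N + n) = x n" unfolding once .
      moreover have "x (Suc (Suc n) + 2 * i) = x (Suc (Suc n))" for i
      proof (induction i)
        case (Suc i)
        have "x (Suc n + Suc (Suc (Suc (2 * i)))) = x (Suc n + Suc (2 * i))"
          using shift[OF per, of "Suc (2 * i)"] by simp
        with Suc show ?case by simp
      qed simp
      moreover have "2 * N + n = Suc (Suc n) + 2 * (N - 1)" using N(1) by linarith
      ultimately have "x n = x (Suc (Suc n))" by metis
      with ne show False by contradiction
    qed
  qed
  then show ?thesis
    unfolding strictly_preperiodic_def strictly_periodic_2_iff
    by (auto simp: x_def)
qed

lemma preper_locus_eq:
  "preper_locus k n = (\<lambda>(a, u). moduli_pt a (a + u)) ` {(a, u). strictly_preperiodic k n (cubic a (a + u)) a}"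
proof -
  have "moduli_pt a b \<in> (\<lambda>(a, u). moduli_pt a (a + u)) ` {(a, u). strictly_preperiodic k n (cubic a (a + u)) a}"
    if "strictly_preperiodic k n (cubic a b) a" for a b
    using that by (intro image_eqI[of _ _ "(a, b - a)"]) auto
  then show ?thesis unfolding preper_locus_def by auto
qed

text \<open>The index is shifted: the critical point is strictly \<open>(n + 1, 2)\<close>-preperiodic.\<close>

definition two_preperiodic :: "nat \<Rightarrow> 'a::idom \<Rightarrow> 'a \<Rightarrow> bool" where
  "two_preperiodic n a u \<longleftrightarrow> crit_orbit a u (Suc (Suc (Suc n))) = crit_orbit a u (Suc n) \<and>
     crit_orbit a u (Suc (Suc n)) \<noteq> crit_orbit a u (Suc n) \<and> crit_orbit a u n \<noteq> crit_orbit a u (Suc (Suc n))"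

lemma preper_locus_Suc_2:
  "preper_locus (Suc n) 2 = (\<lambda>(a, u). moduli_pt a (a + u)) ` {(a, u). two_preperiodic n a u}"
  unfolding preper_locus_eq strictly_preperiodic_2_iff cubic_funpow_crit_orbit two_preperiodic_def ..

lemma two_preperiodic_imp_preper2_poly:
  assumes "two_preperiodic n a u"
  shows "preper2_poly a u n = 0"
proof -
  have "collision_poly a u n = 0"
    using assms crit_orbit_two_step[of a u n] unfolding two_preperiodic_def by auto
  moreover have "preper1_poly a u n \<noteq> 0"
    using assms crit_orbit_step[of a u n] unfolding two_preperiodic_def by auto
  ultimately show ?thesis by (simp add: collision_poly_factor)
qed

text \<open>Where E = 0 the point a has period 2, contradicting x_n \<noteq> x_(n+2). This allows
  the factor E of R to be discarded for even n.\<close>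

lemma two_preperiodic_imp_period2_poly:
  assumes "two_preperiodic n a u"
  shows "period2_poly a u \<noteq> 0 \<or> odd n"
proof (rule ccontr)
  assume "\<not> ?thesis"
  then have E: "period2_poly a u = 0" "even n" by auto
  have "crit_orbit a u (Suc (Suc 0)) = crit_orbit a u 0" by (simp add: crit_orbit_2 E del: crit_orbit.simps(2))
  then have "crit_orbit a u (Suc (Suc n)) = crit_orbit a u n"
    by (induction n) simp_all
  with assms show False by (simp add: two_preperiodic_def)
qed

definition nondegeneracy_poly :: "nat \<Rightarrow> 'a::idom \<Rightarrow> 'a \<Rightarrow> 'a" where
  "nondegeneracy_poly n a u = (crit_orbit a u (Suc (Suc n)) - crit_orbit a u (Suc n))
     * (crit_orbit a u n - crit_orbit a u (Suc (Suc n)))"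

lemma hom_nondegeneracy_poly:
  "is_hom h \<Longrightarrow> h (nondegeneracy_poly n a u) = nondegeneracy_poly n (h a) (h u)"
  by (simp add: nondegeneracy_poly_def is_hom_simps hom_crit_orbit del: crit_orbit.simps)

lemma preper2_poly_imp_two_preperiodic:
  assumes "preper2_poly a u n = 0" "nondegeneracy_poly n a u \<noteq> 0"
  shows "two_preperiodic n a u"
  using assms crit_orbit_two_step[of a u n]
  unfolding two_preperiodic_def nondegeneracy_poly_def collision_poly_factor by auto

lemma irreducible_preper_locus_0: "irreducible_curve M3 (M3 closure_of preper_locus 0 2)"
proof -
  define E where "E = (period2_poly a_var u_var :: int poly poly)"
  have E: "prime_elem E" "degree E > 0" "lead_coeff E = 1"
    using int_poly_poly_prime_elem[OF irreducible_period2_poly]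
    unfolding E_def period2_poly_vars by simp_all
  obtain w where w: "w \<in> rat_fps" "period2_poly fls_X_inv (fps_to_fls w * fls_X_inv) = 0"
    by (rule period2_branch)
  have "eval2 of_int fls_X_inv (fps_to_fls w * fls_X_inv) E = 0"
    unfolding E_def using w(2)
    by (simp only: hom_period2_poly[OF is_hom_eval2[OF is_hom_of_int_fun]] eval2_vars[OF is_hom_of_int_fun])
  note prime = prime_elem_complex_pp[OF E w(1) this]
  have ev: "evalc a u (complex_pp E) = period2_poly a u" for a u
    unfolding eval2_complex_pp[OF is_hom_id] E_def
    by (simp only: hom_period2_poly[OF is_hom_eval2[OF is_hom_of_int_fun]] eval2_vars[OF is_hom_of_int_fun])
  have per: "strictly_preperiodic 0 2 (cubic a (a + u)) a \<longleftrightarrow> period2_poly a u = 0" for a u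
  proof -
    have "strictly_preperiodic 0 2 (cubic a (a + u)) a
        \<longleftrightarrow> crit_orbit a u (Suc (Suc 0)) = a \<and> crit_orbit a u (Suc 0) \<noteq> a"
      unfolding strictly_preperiodic_def cubic_funpow_crit_orbit[symmetric]
      by (simp add: strictly_periodic_2_iff)
    also have "\<dots> \<longleftrightarrow> u * period2_poly a u = 0 \<and> u \<noteq> 0"
      by (simp add: crit_orbit_2 crit_orbit_Suc_0 del: crit_orbit.simps)
    also have "\<dots> \<longleftrightarrow> period2_poly a u = 0" by (auto simp: period2_poly_def)
    finally show ?thesis .
  qed
  show ?thesis
    unfolding preper_locus_eq
  \<comment> \<open>No point has to be discarded, hence D = 1: E = 0 already excludes u = 0.\<close>
  proof (rule plane_curve_image_irreducible[OF prime, of 1])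
    show "degree (complex_pp E) > 0" "lead_coeff (complex_pp E) = 1"
      using E by (simp_all add: degree_complex_pp coeff_complex_pp)
    show "\<not> complex_pp E dvd 1" using prime by (simp add: prime_elem_not_unit)
  qed (simp_all add: per ev)
qed

lemma prime_elem_linear:
  fixes c :: "'a::idom"
  shows "prime_elem [:- c, 1:]"
proof (rule prime_elemI)
  show "\<not> [:- c, 1:] dvd 1" using dvd_imp_degree_le[of "[:- c, 1:]" 1] by auto
  show "[:- c, 1:] dvd p \<or> [:- c, 1:] dvd q" if "[:- c, 1:] dvd p * q" for p q
    using that unfolding poly_eq_0_iff_dvd[symmetric] by simp
qed simp

lemma crit_orbit_minus: "crit_orbit (- a) (- u) n = - crit_orbit a u n"
  by (induction n) (simp_all add: algebra_simps power2_eq_square power3_eq_cube)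

lemma preper2_poly_0: "preper2_poly a u 0 = (1 + u ^ 2) * period2_poly a u"
  unfolding preper2_poly_def crit_orbit_2 crit_orbit_Suc_0 crit_orbit.simps(1) period2_poly_def
  by algebra

text \<open>In the \<open>(a, u)\<close>-plane this locus is dense in the two lines \<open>u = \<i>\<close> and \<open>u = - \<i>\<close>,
  which \<open>(a, u) \<mapsto> (- a, - u)\<close> interchanges.\<close>

lemma irreducible_preper_locus_1: "irreducible_curve M3 (M3 closure_of preper_locus (Suc 0) 2)"
proof -
  define T where "T = {(a :: complex, u). two_preperiodic 0 a u \<and> u = \<i>}"
  define F :: "complex poly poly" where "F = [:- [:\<i>:], 1:]"
  define D :: "complex poly poly" where "D = nondegeneracy_poly 0 a_var u_var"
  have ev_D: "evalc a u D = nondegeneracy_poly 0 a u" for a u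
    unfolding D_def
    by (simp only: hom_nondegeneracy_poly[OF is_hom_evalc] eval2_vars[OF is_hom_id])
  have ev_F: "evalc a u F = u - \<i>" for a u
    unfolding F_def by (simp add: evalc_pCons evalc_0)
  have u: "u = \<i> \<or> u = - \<i>" if "two_preperiodic 0 a u" for a u :: complex
  proof -
    have "crit_orbit a u 0 \<noteq> crit_orbit a u (Suc (Suc 0))" using that by (simp add: two_preperiodic_def)
    then have "period2_poly a u \<noteq> 0" unfolding crit_orbit_2 by auto
    with two_preperiodic_imp_preper2_poly[OF that] have "1 + u ^ 2 = 0" by (simp add: preper2_poly_0)
    then have "(u - \<i>) * (u + \<i>) = 0" by (simp add: algebra_simps power2_eq_square)
    then show ?thesis by (auto simp: eq_neg_iff_add_eq_0)
  qed
  have minus: "two_preperiodic 0 (- a) (- u)" if "two_preperiodic 0 a u" for a u :: complex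
    using that unfolding two_preperiodic_def crit_orbit_minus by (simp del: crit_orbit.simps)
  have "preper_locus (Suc 0) 2 = (\<lambda>(a, u). moduli_pt a (a + u)) ` T"
    unfolding preper_locus_Suc_2
  proof (intro equalityI subsetI)
    fix z :: "complex^3" assume "z \<in> (\<lambda>(a, u). moduli_pt a (a + u)) ` {(a, u). two_preperiodic 0 a u}"
    then obtain a u where au: "two_preperiodic 0 a u" "z = moduli_pt a (a + u)" by auto
    then have "(a, u) \<in> T \<or> (- a, - u) \<in> T" using u[OF au(1)] minus[OF au(1)] unfolding T_def by auto
    moreover have "z = moduli_pt (- a) (- a + - u)" using au(2) moduli_pt_minus[of a "a + u"] by simp
    ultimately show "z \<in> (\<lambda>(a, u). moduli_pt a (a + u)) ` T" using au(2) by force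
  qed (auto simp: T_def)
  moreover have "irreducible_curve M3 (M3 closure_of ((\<lambda>(a, u). moduli_pt a (a + u)) ` T))"
  proof (rule plane_curve_image_irreducible[of F D])
    show "prime_elem F" unfolding F_def by (rule prime_elem_linear)
    show "degree F > 0" "lead_coeff F = 1" by (simp_all add: F_def)
    show "\<not> F dvd D"
    proof
      assume "F dvd D"
      then obtain q where "D = F * q" by blast
      then have "evalc 1 \<i> D = 0" by (simp add: is_hom_mult[OF is_hom_evalc] ev_F)
      \<comment> \<open>For a = 1 and u = \<open>\<i>\<close> the orbit begins 1, 1 + i, -2.\<close>
      moreover have "nondegeneracy_poly 0 1 \<i> \<noteq> 0"
        unfolding nondegeneracy_poly_def crit_orbit_2 crit_orbit_Suc_0 period2_poly_def
        by (simp add: complex_eq_iff)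
      ultimately show False by (simp add: ev_D)
    qed
    show "evalc a u F = 0" if "(a, u) \<in> T" for a u using that by (simp add: T_def ev_F)
    show "(a, u) \<in> T" if "evalc a u F = 0" "evalc a u D \<noteq> 0" for a u
      using that preper2_poly_imp_two_preperiodic[of a u 0] by (simp add: T_def ev_F ev_D preper2_poly_0)
  qed
  ultimately show ?thesis by simp
qed

lemma irreducible_preper_locus_Suc:
  assumes n: "n > 0"
  shows "irreducible_curve M3 (M3 closure_of preper_locus (Suc n) 2)"
proof -
  obtain F :: "int poly poly" where F: "irreducible F" "lead_coeff F = 1" "degree F > 0"
    and R: "preper2_poly a_var u_var n = (if odd n then F else period2_poly a_var u_var * F)"
    using n by (rule irreducible_preper2_factor)
  have prime: "prime_elem F" using F(1) by (rule int_poly_poly_prime_elem)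
  have ev_R: "preper2_poly a u n = (if odd n then eval2 of_int a u F else period2_poly a u * eval2 of_int a u F)"
    for a u :: "'a::idom"
  proof -
    have hom: "is_hom (eval2 of_int a u :: int poly poly \<Rightarrow> 'a)" by (intro is_hom_eval2 is_hom_of_int_fun)
    have "preper2_poly a u n = eval2 of_int a u (preper2_poly a_var u_var n)"
      by (simp only: hom_preper2_poly[OF hom] eval2_vars[OF is_hom_of_int_fun])
    also have "\<dots> = (if odd n then eval2 of_int a u F else period2_poly a u * eval2 of_int a u F)"
      unfolding R
      by (cases "odd n")
        (simp_all add: is_hom_mult[OF hom] hom_period2_poly[OF hom] eval2_vars[OF is_hom_of_int_fun])
    finally show ?thesis .
  qed
  \<comment> \<open>The ring stays arbitrary, for use on the Laurent branch and at complex points of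
    the locus.\<close>
  have F_zero: "eval2 of_int a u F = 0" if "two_preperiodic n a u" for a u :: "'a::idom"
    using two_preperiodic_imp_preper2_poly[OF that] two_preperiodic_imp_period2_poly[OF that] ev_R[of a u]
    by (auto split: if_splits)
  obtain w where w: "w \<in> rat_fps" "two_preperiodic n fls_X_inv (fps_to_fls w * fls_X_inv)"
    using preper2_branch[OF n] unfolding two_preperiodic_def Let_def by metis
  note F0 = F_zero[OF w(2)]
  note prime' = prime_elem_complex_pp[OF prime F(3,2) w(1) F0]
  define D :: "complex poly poly" where "D = nondegeneracy_poly n a_var u_var"
  have ev_D: "eval2 h a u D = nondegeneracy_poly n a u" if "is_hom h" for h :: "complex \<Rightarrow> 'a::idom" and a u
    unfolding D_def
    by (simp only: hom_nondegeneracy_poly[OF is_hom_eval2[OF that]] eval2_vars[OF that])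
  show ?thesis
    unfolding preper_locus_Suc_2
  proof (rule plane_curve_image_irreducible[OF prime', of D])
    show "degree (complex_pp F) > 0" "lead_coeff (complex_pp F) = 1"
      using F by (simp_all add: degree_complex_pp coeff_complex_pp)
    \<comment> \<open>Divisibility is tested on the branch, where neither factor of \<open>D\<close>
      vanishes.\<close>
    show "\<not> complex_pp F dvd D"
      unfolding complex_pp_branch_dvd[OF prime F(3,2) w(1) F0] ev_D[OF is_hom_fls_const]
      using w(2) by (simp add: nondegeneracy_poly_def two_preperiodic_def del: crit_orbit.simps)
    show "evalc a u (complex_pp F) = 0" if "(a, u) \<in> {(a, u). two_preperiodic n a u}" for a u
      using that F_zero[of a u] by (simp add: eval2_complex_pp[OF is_hom_id])
    show "(a, u) \<in> {(a, u). two_preperiodic n a u}" if "evalc a u (complex_pp F) = 0" "evalc a u D \<noteq> 0" for a u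
      using that preper2_poly_imp_two_preperiodic[of a u n] ev_R[of a u]
      by (simp add: eval2_complex_pp[OF is_hom_id] ev_D[OF is_hom_id])
  qed
qed

theorem theorem1p2:
  fixes k :: nat
  shows "irreducible_curve M3 (M3 closure_of preper_locus k 2)"
proof -
  consider "k = 0" | "k = Suc 0" | n where "k = Suc n" "n > 0"
    by (cases k) auto
  then show ?thesis
    using irreducible_preper_locus_0 irreducible_preper_locus_1 irreducible_preper_locus_Suc by cases auto
qed

end
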